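(* Let $X\subset\mathbb{P}^N$ be an irreducible projective variety of dimension $n\geq 1$ with $n\leq N/2$, such that $X\cap\Delta_{N-n-1}=\emptyset$. Then $\operatorname{Hrk}_X(p)\leq N$ for every $p\in\mathbb{P}^N$.
   Context: Work in $\mathbb{P}^N$ over $\mathbb{C}$ with fixed coordinates. For $p=(p_0:\cdots:p_N)$, $q=(q_0:\cdots:q_N)$, the Hadamard product $p\star q=(p_0q_0:\cdots:p_Nq_N)$ is defined whenever not all $p_iq_i$ are zero. The Hadamard-$X$-rank of $q$ is $\operatorname{Hrk}_X(q)=\min\{m\mid q=p_1\star\cdots\star p_m,\ p_i\in X\}$, or $\infty$ if no such decomposition exists. For $0\le i\le N$, $\Delta_i\subset\mathbb{P}^N$ is the set of points with at most $i+1$ nonzero coordinates; thus $\Delta_{N-k}$ is the set of points with at least $k$ coordinates equal to zero. *)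

theory Defs
  imports Complex_Main "HOL-Library.Poly_Mapping" "HOL-Library.Extended_Nat"
begin

text \<open>Points of P^N are represented by nonzero vectors v :: nat => complex with
  v i = 0 for i > N (homogeneous coordinates v 0, ..., v N). A subset of P^N is
  represented by its (punctured) affine cone, i.e. the set of all representatives.\<close>

definition pvec :: "nat \<Rightarrow> (nat \<Rightarrow> complex) \<Rightarrow> bool" where
  "pvec N v \<longleftrightarrow> (\<forall>i>N. v i = 0) \<and> (\<exists>i\<le>N. v i \<noteq> 0)"

definition proj_eq :: "(nat \<Rightarrow> complex) \<Rightarrow> (nat \<Rightarrow> complex) \<Rightarrow> bool" where
  "proj_eq v w \<longleftrightarrow> (\<exists>c. c \<noteq> 0 \<and> w = (\<lambda>i. c * v i))"

definition mon_eval :: "(nat \<Rightarrow>\<^sub>0 nat) \<Rightarrow> (nat \<Rightarrow> complex) \<Rightarrow> complex" where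
  "mon_eval m v = (\<Prod>i\<in>Poly_Mapping.keys m. v i ^ Poly_Mapping.lookup m i)"

definition poly_eval :: "((nat \<Rightarrow>\<^sub>0 nat) \<Rightarrow>\<^sub>0 complex) \<Rightarrow> (nat \<Rightarrow> complex) \<Rightarrow> complex" where
  "poly_eval f v = (\<Sum>m\<in>Poly_Mapping.keys f. Poly_Mapping.lookup f m * mon_eval m v)"

definition homog_poly :: "nat \<Rightarrow> ((nat \<Rightarrow>\<^sub>0 nat) \<Rightarrow>\<^sub>0 complex) \<Rightarrow> bool" where
  "homog_poly N f \<longleftrightarrow>
     (\<exists>d. \<forall>m\<in>Poly_Mapping.keys f. Poly_Mapping.keys m \<subseteq> {..N} \<and> (\<Sum>i\<in>Poly_Mapping.keys m. Poly_Mapping.lookup m i) = d)"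

definition proj_zero_set :: "nat \<Rightarrow> ((nat \<Rightarrow>\<^sub>0 nat) \<Rightarrow>\<^sub>0 complex) set \<Rightarrow> (nat \<Rightarrow> complex) set" where
  "proj_zero_set N F = {v. pvec N v \<and> (\<forall>f\<in>F. poly_eval f v = 0)}"

definition proj_closed :: "nat \<Rightarrow> (nat \<Rightarrow> complex) set \<Rightarrow> bool" where
  "proj_closed N S \<longleftrightarrow> (\<exists>F. (\<forall>f\<in>F. homog_poly N f) \<and> S = proj_zero_set N F)"

definition proj_irreducible :: "nat \<Rightarrow> (nat \<Rightarrow> complex) set \<Rightarrow> bool" where
  "proj_irreducible N X \<longleftrightarrow> proj_closed N X \<and> X \<noteq> {} \<and>
     (\<forall>A B. proj_closed N A \<and> proj_closed N B \<and> X = A \<union> B \<longrightarrow> X = A \<or> X = B)"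

definition irred_chain :: "nat \<Rightarrow> (nat \<Rightarrow> complex) set \<Rightarrow> (nat \<Rightarrow> (nat \<Rightarrow> complex) set) \<Rightarrow> nat \<Rightarrow> bool" where
  "irred_chain N X Z k \<longleftrightarrow> (\<forall>i\<le>k. proj_irreducible N (Z i) \<and> Z i \<subseteq> X) \<and> (\<forall>i<k. Z i \<subset> Z (Suc i))"

definition proj_dim :: "nat \<Rightarrow> (nat \<Rightarrow> complex) set \<Rightarrow> nat \<Rightarrow> bool" where
  "proj_dim N X n \<longleftrightarrow> (\<exists>Z. irred_chain N X Z n) \<and> \<not> (\<exists>Z. irred_chain N X Z (Suc n))"

definition hprod :: "(nat \<Rightarrow> complex) list \<Rightarrow> (nat \<Rightarrow> complex)" where
  "hprod ps = (\<lambda>i. prod_list (map (\<lambda>p. p i) ps))"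

text \<open>q = p_1 * ... * p_m with p_i in X (product defined, i.e. not identically zero).\<close>
definition hadamard_decomp :: "nat \<Rightarrow> (nat \<Rightarrow> complex) set \<Rightarrow> (nat \<Rightarrow> complex) \<Rightarrow> nat \<Rightarrow> bool" where
  "hadamard_decomp N X q m \<longleftrightarrow>
     (\<exists>ps. length ps = m \<and> m \<ge> 1 \<and> set ps \<subseteq> X \<and> pvec N (hprod ps) \<and> proj_eq (hprod ps) q)"

definition Hrk :: "nat \<Rightarrow> (nat \<Rightarrow> complex) set \<Rightarrow> (nat \<Rightarrow> complex) \<Rightarrow> enat" where
  "Hrk N X q = (if \<exists>m. hadamard_decomp N X q m
                then enat (LEAST m. hadamard_decomp N X q m) else \<infinity>)"

definition Delta :: "nat \<Rightarrow> nat \<Rightarrow> (nat \<Rightarrow> complex) set" where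
  "Delta N i = {v. pvec N v \<and> card {j. j \<le> N \<and> v j \<noteq> 0} \<le> i + 1}"

end

theory Submission
  imports Defs "HOL-Analysis.Continuum_Not_Denumerable" "HOL-Library.FuncSet"
    "HOL-Computational_Algebra.Fundamental_Theorem_Algebra"
begin

text \<open>Cutting \<open>X\<close> with \<open>n - 1\<close> general hyperplanes gives a curve \<open>C\<close> all of whose points have at most one
  zero coordinate: by induction, on a closed set whose points have at most \<open>m\<close> zero coordinates those
  with exactly \<open>m\<close> of them are finite in number, so a general hyperplane avoids them. Products of \<open>N\<close> points
  of \<open>C\<close> are therefore never zero. The product is given by forms of multidegree \<open>(1, \<dots>, 1)\<close> on
  \<open>C\<^sup>N\<close>, a variety of dimension \<open>N\<close>, so the \<open>N\<close> linear equations that cut out a point \<open>p\<close> of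
  projective space have a common solution on \<open>C\<^sup>N\<close>, which writes \<open>p\<close> as a product.

  All existence statements come from one fact: \<open>k\<close> linear forms have a common zero on a projective
  set whose coordinate ring contains \<open>k + 1\<close> algebraically independent elements. Otherwise, by the
  Nullstellensatz, the coordinate ring would be finite over the ring generated by the \<open>k\<close> forms, and
  counting monomials of bounded degree gives a contradiction. On \<open>X\<close> itself \<open>n + 1\<close> independent
  elements are read off a chain of irreducible closed subsets.\<close>

subsection \<open>Linear dependence of functions\<close>

text \<open>Gaussian elimination: eliminating an unknown \<open>a0\<close> that occurs in the
  equation \<open>t\<close> costs one equation and one unknown, so the system stays
  underdetermined.\<close>

lemma homogeneous_system_nontrivial_solution:
  fixes c :: "'a \<Rightarrow> 'b \<Rightarrow> 'k::field"
  assumes "finite T" "finite A" "card T < card A"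
  shows "\<exists>l. (\<exists>a\<in>A. l a \<noteq> 0) \<and> (\<forall>t\<in>T. (\<Sum>a\<in>A. l a * c a t) = 0)"
  using assms
proof (induction T arbitrary: A c rule: finite_induct)
  case empty
  then obtain a where "a \<in> A" by fastforce
  then show ?case by (intro exI[of _ "\<lambda>_. 1"]) auto
next
  case (insert t T)
  show ?case
  proof (cases "\<forall>a\<in>A. c a t = 0")
    case True
    have "card T < card A" using insert by simp
    then obtain l where "\<exists>a\<in>A. l a \<noteq> 0" "\<forall>t\<in>T. (\<Sum>a\<in>A. l a * c a t) = 0"
      using insert.IH[of A c] insert.prems by blast
    then show ?thesis using True by (intro exI[of _ l]) auto
  next
    case False
    then obtain a0 where a0: "a0 \<in> A" "c a0 t \<noteq> 0" by blast
    define A' where "A' = A - {a0}"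
    have A: "A = insert a0 A'" "a0 \<notin> A'" "finite A'"
      using a0 insert.prems by (auto simp: A'_def)
    define c' where "c' a s = c a s - c a t / c a0 t * c a0 s" for a s
    have "card T < card A'" using insert A by simp
    then obtain l where l: "\<exists>a\<in>A'. l a \<noteq> 0" "\<forall>s\<in>T. (\<Sum>a\<in>A'. l a * c' a s) = 0"
      using insert.IH[of A' c'] A by blast
    \<comment> \<open>The value at \<open>a0\<close> is forced by the equation \<open>t\<close>;
      with it, every original equation becomes the eliminated one with coefficients
      \<open>c'\<close>.\<close>
    define m where "m = l(a0 := - (\<Sum>a\<in>A'. l a * (c a t / c a0 t)))"
    have sum_m: "(\<Sum>a\<in>A. m a * c a s) = (\<Sum>a\<in>A'. l a * c' a s)" for s
    proof -
      have "(\<Sum>a\<in>A'. m a * c a s) = (\<Sum>a\<in>A'. l a * c a s)"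
        using A by (intro sum.cong) (auto simp: m_def)
      then show ?thesis using A
        by (simp add: m_def c'_def algebra_simps sum_subtractf sum_distrib_left sum_distrib_right)
    qed
    have "c' a t = 0" for a using a0 by (simp add: c'_def)
    then have "\<forall>s\<in>insert t T. (\<Sum>a\<in>A. m a * c a s) = 0"
      using sum_m l(2) by simp
    moreover have "\<exists>a\<in>A. m a \<noteq> 0" using l(1) A by (auto simp: m_def)
    ultimately show ?thesis by blast
  qed
qed

text \<open>Equality is demanded on \<open>S\<close> only, so this is a span modulo the functions
  vanishing on \<open>S\<close>, as in a coordinate ring.\<close>

definition lin_span :: "'p set \<Rightarrow> 't set \<Rightarrow> ('t \<Rightarrow> 'p \<Rightarrow> complex) \<Rightarrow> ('p \<Rightarrow> complex) \<Rightarrow> bool" where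
  "lin_span S T g f \<longleftrightarrow> (\<exists>c. \<forall>z\<in>S. f z = (\<Sum>t\<in>T. c t * g t z))"

lemma lin_span_0: "lin_span S T g (\<lambda>_. 0)"
  unfolding lin_span_def by (intro exI[of _ "\<lambda>_. 0"]) auto

lemma lin_span_add:
  assumes "lin_span S T g f" "lin_span S T g f'"
  shows "lin_span S T g (\<lambda>z. f z + f' z)"
proof -
  obtain c c' where "\<forall>z\<in>S. f z = (\<Sum>t\<in>T. c t * g t z)" "\<forall>z\<in>S. f' z = (\<Sum>t\<in>T. c' t * g t z)"
    using assms unfolding lin_span_def by blast
  then show ?thesis unfolding lin_span_def
    by (intro exI[of _ "\<lambda>t. c t + c' t"]) (auto simp: sum.distrib algebra_simps)
qed

lemma lin_span_scale:
  assumes "lin_span S T g f"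
  shows "lin_span S T g (\<lambda>z. a * f z)"
proof -
  obtain c where "\<forall>z\<in>S. f z = (\<Sum>t\<in>T. c t * g t z)"
    using assms unfolding lin_span_def by blast
  then show ?thesis unfolding lin_span_def
    by (intro exI[of _ "\<lambda>t. a * c t"]) (auto simp: sum_distrib_left algebra_simps)
qed

lemma lin_span_sum:
  assumes "\<And>a. a \<in> A \<Longrightarrow> lin_span S T g (f a)"
  shows "lin_span S T g (\<lambda>z. \<Sum>a\<in>A. f a z)"
  using assms
  by (induction A rule: infinite_finite_induct) (auto intro: lin_span_0 lin_span_add)

lemma lin_span_base:
  assumes "finite T" "t \<in> T"
  shows "lin_span S T g (g t)"
  unfolding lin_span_def
  using assms by (intro exI[of _ "\<lambda>s. if s = t then 1 else 0"]) (auto simp: if_distrib if_distribR cong: if_cong)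

lemma lin_span_cong:
  assumes "\<And>z. z \<in> S \<Longrightarrow> f z = f' z"
  shows "lin_span S T g f \<longleftrightarrow> lin_span S T g f'"
  using assms unfolding lin_span_def by auto

lemma lin_span_trans:
  assumes "lin_span S T g f" "\<And>t. t \<in> T \<Longrightarrow> lin_span S T' g' (g t)"
  shows "lin_span S T' g' f"
proof -
  obtain c where c: "\<forall>z\<in>S. f z = (\<Sum>t\<in>T. c t * g t z)"
    using assms(1) unfolding lin_span_def by blast
  have "lin_span S T' g' (\<lambda>z. \<Sum>t\<in>T. c t * g t z)"
    using assms(2) by (intro lin_span_sum lin_span_scale)
  then show ?thesis using c by (subst lin_span_cong[of S f]) auto
qed

lemma lin_span_mono:
  assumes "lin_span S T g f" "T \<subseteq> T'" "finite T'"
  shows "lin_span S T' g f"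
  using lin_span_trans[OF assms(1), of T' g] lin_span_base[OF assms(3)] assms(2) by blast

lemma lin_span_mult:
  assumes "lin_span S T g f" "\<And>t. t \<in> T \<Longrightarrow> lin_span S T' g' (\<lambda>z. q z * g t z)"
  shows "lin_span S T' g' (\<lambda>z. q z * f z)"
proof -
  have "lin_span S T (\<lambda>t z. q z * g t z) (\<lambda>z. q z * f z)"
    using assms(1) unfolding lin_span_def
    by (auto simp: sum_distrib_left algebra_simps)
  then show ?thesis using assms(2) by (rule lin_span_trans)
qed

text \<open>A kernel vector of the coefficient matrix is a relation. Both dimension counts end here:
  the one behind the Nullstellensatz and the comparison of Hilbert functions.\<close>

lemma lin_span_dependent:
  assumes "finite T" "finite A" "card T < card A" "\<And>a. a \<in> A \<Longrightarrow> lin_span S T g (f a)"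
  shows "\<exists>c. (\<exists>a\<in>A. c a \<noteq> 0) \<and> (\<forall>z\<in>S. (\<Sum>a\<in>A. c a * f a z) = 0)"
proof -
  obtain b where b: "\<And>a z. a \<in> A \<Longrightarrow> z \<in> S \<Longrightarrow> f a z = (\<Sum>t\<in>T. b a t * g t z)"
    using assms(4) unfolding lin_span_def by metis
  obtain l where l: "\<exists>a\<in>A. l a \<noteq> 0" "\<And>t. t \<in> T \<Longrightarrow> (\<Sum>a\<in>A. l a * b a t) = 0"
    using homogeneous_system_nontrivial_solution[OF assms(1-3), of b] by blast
  have "(\<Sum>a\<in>A. l a * f a z) = 0" if "z \<in> S" for z
  proof -
    have "(\<Sum>a\<in>A. l a * f a z) = (\<Sum>a\<in>A. \<Sum>t\<in>T. l a * b a t * g t z)"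
      using b that by (simp add: sum_distrib_left mult.assoc)
    also have "\<dots> = (\<Sum>t\<in>T. (\<Sum>a\<in>A. l a * b a t) * g t z)"
      by (subst sum.swap) (simp add: sum_distrib_right)
    finally show ?thesis using l(2) by simp
  qed
  then show ?thesis using l(1) by blast
qed

subsection \<open>Homogeneous and polynomial functions\<close>

text \<open>Forms are treated as functions over an arbitrary index set, because the results are
  applied both to the coordinates \<open>{..N}\<close> and to Segre coordinates, whose indices are
  themselves functions. Zero has every degree, so each degree is a vector space.\<close>

inductive hom_fun :: "'i set \<Rightarrow> nat \<Rightarrow> (('i \<Rightarrow> complex) \<Rightarrow> complex) \<Rightarrow> bool" for I where
  hom_const: "hom_fun I 0 (\<lambda>_. c)"
| hom_zero: "hom_fun I d (\<lambda>_. 0)"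
| hom_add: "hom_fun I d f \<Longrightarrow> hom_fun I d g \<Longrightarrow> hom_fun I d (\<lambda>z. f z + g z)"
| hom_var_mult: "i \<in> I \<Longrightarrow> hom_fun I d f \<Longrightarrow> hom_fun I (Suc d) (\<lambda>z. z i * f z)"

inductive poly_deg :: "'i set \<Rightarrow> nat \<Rightarrow> (('i \<Rightarrow> complex) \<Rightarrow> complex) \<Rightarrow> bool" for I where
  pd_const: "poly_deg I D (\<lambda>_. c)"
| pd_add: "poly_deg I D f \<Longrightarrow> poly_deg I D g \<Longrightarrow> poly_deg I D (\<lambda>z. f z + g z)"
| pd_var_mult: "i \<in> I \<Longrightarrow> poly_deg I D f \<Longrightarrow> poly_deg I (Suc D) (\<lambda>z. z i * f z)"

lemma hom_var: "i \<in> I \<Longrightarrow> hom_fun I 1 (\<lambda>z. z i)"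
  using hom_var_mult[of i I 0 "\<lambda>_. 1"] hom_const[of I 1] by simp

lemma hom_scale: "hom_fun I d f \<Longrightarrow> hom_fun I d (\<lambda>z. c * f z)"
proof (induction rule: hom_fun.induct)
  case (hom_var_mult i d f)
  then show ?case using hom_fun.hom_var_mult[of i I d "\<lambda>z. c * f z"] by (simp add: algebra_simps)
qed (auto simp: algebra_simps intro: hom_fun.intros)

lemma hom_diff: "hom_fun I d f \<Longrightarrow> hom_fun I d g \<Longrightarrow> hom_fun I d (\<lambda>z. f z - g z)"
  using hom_add[of I d f "\<lambda>z. (-1) * g z"] hom_scale[of I d g "-1"] by simp

lemma hom_mult: "hom_fun I d f \<Longrightarrow> hom_fun I e g \<Longrightarrow> hom_fun I (d + e) (\<lambda>z. f z * g z)"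
proof (induction rule: hom_fun.induct)
  case (hom_var_mult i d f)
  then show ?case using hom_fun.hom_var_mult[of i I "d + e" "\<lambda>z. f z * g z"] by (simp add: algebra_simps)
qed (auto simp: algebra_simps intro: hom_fun.intros hom_scale)

lemma hom_sum:
  "(\<And>a. a \<in> A \<Longrightarrow> hom_fun I d (f a)) \<Longrightarrow> hom_fun I d (\<lambda>z. \<Sum>a\<in>A. f a z)"
  by (induction A rule: infinite_finite_induct) (auto intro: hom_fun.intros)

lemma hom_prod:
  "finite A \<Longrightarrow> (\<And>a. a \<in> A \<Longrightarrow> hom_fun I (e a) (f a)) \<Longrightarrow> hom_fun I (\<Sum>a\<in>A. e a) (\<lambda>z. \<Prod>a\<in>A. f a z)"
  by (induction A rule: finite_induct) (auto intro: hom_const hom_mult)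

lemma hom_power: "hom_fun I d f \<Longrightarrow> hom_fun I (k * d) (\<lambda>z. f z ^ k)"
  by (induction k) (auto intro: hom_const hom_mult)

lemma hom_var_power: "i \<in> I \<Longrightarrow> hom_fun I k (\<lambda>z. z i ^ k)"
  using hom_power[OF hom_var, of i I k] by simp

lemma hom_eval_scale: "hom_fun I d f \<Longrightarrow> f (\<lambda>i. t * z i) = t ^ d * f z"
  by (induction rule: hom_fun.induct) (auto simp: algebra_simps)

lemma hom_eval_cong: "hom_fun I d f \<Longrightarrow> (\<And>i. i \<in> I \<Longrightarrow> z i = w i) \<Longrightarrow> f z = f w"
  by (induction rule: hom_fun.induct) auto

lemma hom_rename:
  "hom_fun I d f \<Longrightarrow> (\<And>i. i \<in> I \<Longrightarrow> s i \<in> I') \<Longrightarrow> hom_fun I' d (\<lambda>z. f (\<lambda>i. z (s i)))"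
  by (induction rule: hom_fun.induct) (auto intro: hom_fun.intros)

lemma pd_mono: "poly_deg I D f \<Longrightarrow> D \<le> E \<Longrightarrow> poly_deg I E f"
proof (induction arbitrary: E rule: poly_deg.induct)
  case (pd_var_mult i D f)
  then obtain E' where "E = Suc E'" "D \<le> E'" by (cases E) auto
  then show ?case using pd_var_mult by (auto intro: poly_deg.intros)
qed (auto intro: poly_deg.intros)

lemma hom_imp_pd: "hom_fun I d f \<Longrightarrow> poly_deg I d f"
  by (induction rule: hom_fun.induct) (auto intro: poly_deg.intros)

lemma pd_scale: "poly_deg I D f \<Longrightarrow> poly_deg I D (\<lambda>z. c * f z)"
proof (induction rule: poly_deg.induct)
  case (pd_var_mult i D f)
  then show ?case using poly_deg.pd_var_mult[of i I D "\<lambda>z. c * f z"] by (simp add: algebra_simps)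
qed (auto simp: algebra_simps intro: poly_deg.intros)

lemma pd_mult: "poly_deg I D f \<Longrightarrow> poly_deg I E g \<Longrightarrow> poly_deg I (D + E) (\<lambda>z. f z * g z)"
proof (induction rule: poly_deg.induct)
  case (pd_const D c)
  then show ?case using pd_mono[OF pd_scale] by force
next
  case (pd_var_mult i D f)
  then show ?case using poly_deg.pd_var_mult[of i I "D + E" "\<lambda>z. f z * g z"] by (simp add: algebra_simps)
qed (auto simp: algebra_simps intro: poly_deg.intros)

lemma pd_power: "poly_deg I D f \<Longrightarrow> poly_deg I (k * D) (\<lambda>z. f z ^ k)"
  by (induction k) (auto intro: pd_const pd_mult)

lemma pd_prod:
  "finite A \<Longrightarrow> (\<And>a. a \<in> A \<Longrightarrow> poly_deg I D (f a)) \<Longrightarrow> poly_deg I (card A * D) (\<lambda>z. \<Prod>a\<in>A. f a z)"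
  by (induction A rule: finite_induct) (auto intro: pd_const pd_mult)

lemma pd_decompose:
  "poly_deg I D f \<Longrightarrow> \<exists>h. (\<forall>d. hom_fun I d (h d)) \<and> f = (\<lambda>z. \<Sum>d\<le>D. h d z)"
proof (induction rule: poly_deg.induct)
  case (pd_const D c)
  define h :: "nat \<Rightarrow> ('a \<Rightarrow> complex) \<Rightarrow> complex"
    where "h d = (if d = 0 then (\<lambda>z. c) else (\<lambda>z. 0))" for d
  have "(\<Sum>d\<le>D. h d z) = c" for z
    by (simp add: h_def if_distribR if_distrib cong: if_cong)
  moreover have "hom_fun I d (h d)" for d by (auto simp: h_def intro: hom_fun.intros)
  ultimately show ?case by (intro exI[of _ h]) auto
next
  case (pd_add D f g)
  then obtain h h' where "\<forall>d. hom_fun I d (h d)" "f = (\<lambda>z. \<Sum>d\<le>D. h d z)"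
    "\<forall>d. hom_fun I d (h' d)" "g = (\<lambda>z. \<Sum>d\<le>D. h' d z)" by blast
  then show ?case
    by (intro exI[of _ "\<lambda>d z. h d z + h' d z"]) (auto simp: sum.distrib intro: hom_fun.intros)
next
  case (pd_var_mult i D f)
  then obtain h where h: "\<forall>d. hom_fun I d (h d)" "f = (\<lambda>z. \<Sum>d\<le>D. h d z)" by blast
  define h' where "h' d = (case d of 0 \<Rightarrow> (\<lambda>z. 0) | Suc e \<Rightarrow> (\<lambda>z. z i * h e z))" for d
  have "hom_fun I d (h' d)" for d
    using h pd_var_mult by (auto simp: h'_def split: nat.split intro: hom_fun.intros)
  moreover have "z i * f z = (\<Sum>d\<le>Suc D. h' d z)" for z
    by (subst sum.atMost_Suc_shift) (simp add: h'_def h sum_distrib_left)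
  ultimately show ?case by blast
qed

text \<open>Carries identities from the affine chart \<open>z i = 1\<close> back to the cone. As
  \<open>D\<close> only bounds the degree, missing degree is filled up with powers of
  \<open>z i\<close>.\<close>

lemma pd_homogenize:
  assumes "poly_deg I D f" "i \<in> I"
  shows "\<exists>h. hom_fun I D h \<and> (\<forall>z. z i \<noteq> 0 \<longrightarrow> h z = z i ^ D * f (\<lambda>j. z j / z i))"
  using assms(1)
proof (induction rule: poly_deg.induct)
  case (pd_const D c)
  then show ?case using hom_scale[OF hom_var_power[OF assms(2)]]
    by (intro exI[of _ "\<lambda>z. c * z i ^ D"]) auto
next
  case (pd_add D f g)
  then obtain h h' where "hom_fun I D h" "hom_fun I D h'"
    "\<And>z. z i \<noteq> 0 \<Longrightarrow> h z = z i ^ D * f (\<lambda>j. z j / z i)"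
    "\<And>z. z i \<noteq> 0 \<Longrightarrow> h' z = z i ^ D * g (\<lambda>j. z j / z i)" by blast
  then show ?case
    by (intro exI[of _ "\<lambda>z. h z + h' z"]) (auto simp: algebra_simps intro: hom_fun.intros)
next
  case (pd_var_mult k D f)
  then obtain h where "hom_fun I D h" "\<And>z. z i \<noteq> 0 \<Longrightarrow> h z = z i ^ D * f (\<lambda>j. z j / z i)"
    by blast
  then show ?case using pd_var_mult
    by (intro exI[of _ "\<lambda>z. z k * h z"]) (auto simp: algebra_simps intro: hom_fun.intros)
qed

definition poly_fun :: "'i set \<Rightarrow> (('i \<Rightarrow> complex) \<Rightarrow> complex) \<Rightarrow> bool" where
  "poly_fun I f \<longleftrightarrow> (\<exists>D. poly_deg I D f)"

lemma pf_const: "poly_fun I (\<lambda>_. c)"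
  unfolding poly_fun_def by (blast intro: pd_const)

lemma pf_add: "poly_fun I f \<Longrightarrow> poly_fun I g \<Longrightarrow> poly_fun I (\<lambda>z. f z + g z)"
  unfolding poly_fun_def using pd_add[OF pd_mono[OF _ max.cobounded1] pd_mono[OF _ max.cobounded2]] by blast

lemma pf_mult: "poly_fun I f \<Longrightarrow> poly_fun I g \<Longrightarrow> poly_fun I (\<lambda>z. f z * g z)"
  unfolding poly_fun_def by (blast intro: pd_mult)

lemma hom_imp_pf: "hom_fun I d f \<Longrightarrow> poly_fun I f"
  unfolding poly_fun_def by (blast intro: hom_imp_pd)

lemma pf_var: "i \<in> I \<Longrightarrow> poly_fun I (\<lambda>z. z i)"
  by (blast intro: hom_imp_pf hom_var)

lemma pf_diff: "poly_fun I f \<Longrightarrow> poly_fun I g \<Longrightarrow> poly_fun I (\<lambda>z. f z - g z)"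
  using pf_add[of I f "\<lambda>z. (-1) * g z"] pf_mult[of I "\<lambda>_. -1" g] pf_const[of I "-1"] by simp

lemma pf_sum:
  "(\<And>a. a \<in> A \<Longrightarrow> poly_fun I (f a)) \<Longrightarrow> poly_fun I (\<lambda>z. \<Sum>a\<in>A. f a z)"
  by (induction A rule: infinite_finite_induct) (auto intro: pf_const pf_add)

lemma pf_prod:
  "(\<And>a. a \<in> A \<Longrightarrow> poly_fun I (f a)) \<Longrightarrow> poly_fun I (\<lambda>z. \<Prod>a\<in>A. f a z)"
  by (induction A rule: infinite_finite_induct) (auto intro: pf_const pf_mult)

lemma pf_uniform_degree:
  assumes "finite K" "\<And>k. k \<in> K \<Longrightarrow> poly_fun I (g k)"
  shows "\<exists>D. \<forall>k\<in>K. poly_deg I D (g k)"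
proof -
  obtain D where D: "\<And>k. k \<in> K \<Longrightarrow> poly_deg I (D k) (g k)"
    using assms(2) unfolding poly_fun_def by metis
  have "poly_deg I (\<Sum>k\<in>K. D k) (g k)" if "k \<in> K" for k
    using pd_mono[OF D[OF that]] member_le_sum[of k K D] assms(1) that by blast
  then show ?thesis by blast
qed

text \<open>Monomials as words in the variables. Reordered words give the same function, which is
  harmless because monomials serve only as spanning sets.\<close>

definition list_mono :: "'i list \<Rightarrow> ('i \<Rightarrow> complex) \<Rightarrow> complex" where
  "list_mono xs z = prod_list (map z xs)"

definition mono_lists :: "'i set \<Rightarrow> nat \<Rightarrow> 'i list set" where
  "mono_lists I d = {xs. set xs \<subseteq> I \<and> length xs = d}"

lemma finite_mono_lists: "finite I \<Longrightarrow> finite (mono_lists I d)"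
  unfolding mono_lists_def by (rule finite_lists_length_eq)

lemma hom_list_mono: "set xs \<subseteq> I \<Longrightarrow> hom_fun I (length xs) (list_mono xs)"
proof (induction xs)
  case Nil
  then show ?case using hom_const[of I 1] by (simp add: list_mono_def[abs_def])
next
  case (Cons x xs)
  then show ?case using hom_var_mult[of x I "length xs" "list_mono xs"]
    by (simp add: list_mono_def[abs_def])
qed

lemma hom_lin_span:
  assumes "finite I"
  shows "hom_fun I d f \<Longrightarrow> lin_span UNIV (mono_lists I d) list_mono f"
proof (induction rule: hom_fun.induct)
  case (hom_const c)
  have "mono_lists I 0 = {[]}" by (auto simp: mono_lists_def)
  then show ?case by (auto simp: lin_span_def list_mono_def)
next
  case (hom_var_mult i d f)
  show ?case
  proof (rule lin_span_mult[OF hom_var_mult.IH])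
    fix xs assume "xs \<in> mono_lists I d"
    then have "i # xs \<in> mono_lists I (Suc d)" using hom_var_mult by (auto simp: mono_lists_def)
    from lin_span_base[OF finite_mono_lists[OF assms] this, of UNIV list_mono]
    show "lin_span UNIV (mono_lists I (Suc d)) list_mono (\<lambda>z. z i * list_mono xs z)"
      by (simp add: list_mono_def[abs_def])
  qed
qed (auto intro: lin_span_0 lin_span_add)

lemma pd_lin_span:
  assumes "finite I" "poly_deg I D f"
  shows "lin_span UNIV (\<Union>d\<le>D. mono_lists I d) list_mono f"
proof -
  obtain h where h: "\<forall>d. hom_fun I d (h d)" "f = (\<lambda>z. \<Sum>d\<le>D. h d z)"
    using pd_decompose[OF assms(2)] by blast
  show ?thesis unfolding h(2)
  proof (rule lin_span_sum)
    fix d assume "d \<in> {..D}"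
    then show "lin_span UNIV (\<Union>d\<le>D. mono_lists I d) list_mono (h d)"
      using h(1) finite_mono_lists[OF assms(1)]
      by (intro lin_span_mono[OF hom_lin_span[OF assms(1)]]) auto
  qed
qed

subsection \<open>The Nullstellensatz\<close>

definition poly_ideal :: "'i set \<Rightarrow> (('i \<Rightarrow> complex) \<Rightarrow> complex) set \<Rightarrow> bool" where
  "poly_ideal I J \<longleftrightarrow> J \<subseteq> Collect (poly_fun I) \<and> (\<lambda>_. 0) \<in> J \<and>
     (\<forall>f\<in>J. \<forall>g\<in>J. (\<lambda>z. f z + g z) \<in> J) \<and>
     (\<forall>f\<in>J. \<forall>q. poly_fun I q \<longrightarrow> (\<lambda>z. q z * f z) \<in> J)"

lemma poly_ideal_add: "poly_ideal I J \<Longrightarrow> f \<in> J \<Longrightarrow> g \<in> J \<Longrightarrow> (\<lambda>z. f z + g z) \<in> J"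
  and poly_ideal_mult: "poly_ideal I J \<Longrightarrow> poly_fun I q \<Longrightarrow> f \<in> J \<Longrightarrow> (\<lambda>z. q z * f z) \<in> J"
  and poly_ideal_0: "poly_ideal I J \<Longrightarrow> (\<lambda>_. 0) \<in> J"
  and poly_ideal_pf: "poly_ideal I J \<Longrightarrow> f \<in> J \<Longrightarrow> poly_fun I f"
  unfolding poly_ideal_def by auto

lemma poly_ideal_sum:
  assumes "poly_ideal I J" "\<And>a. a \<in> A \<Longrightarrow> f a \<in> J"
  shows "(\<lambda>z. \<Sum>a\<in>A. f a z) \<in> J"
  using assms(2)
  by (induction A rule: infinite_finite_induct)
    (auto intro: poly_ideal_0[OF assms(1)] poly_ideal_add[OF assms(1)])

lemma poly_ideal_const:
  assumes "poly_ideal I J" "(\<lambda>_. c) \<in> J" "c \<noteq> 0"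
  shows "(\<lambda>_. 1) \<in> J"
  using poly_ideal_mult[OF assms(1) pf_const[of I "1 / c"] assms(2)] assms(3) by simp

definition maximal_ideal :: "'i set \<Rightarrow> (('i \<Rightarrow> complex) \<Rightarrow> complex) set \<Rightarrow> bool" where
  "maximal_ideal I M \<longleftrightarrow> poly_ideal I M \<and> (\<lambda>_. 1) \<notin> M \<and>
     (\<forall>M'. poly_ideal I M' \<and> M \<subseteq> M' \<and> (\<lambda>_. 1) \<notin> M' \<longrightarrow> M' = M)"

text \<open>Zorn's lemma: the union of a chain of proper ideals is proper, since \<open>1\<close>
  would already lie in one of them.\<close>

lemma maximal_ideal_exists:
  assumes "poly_ideal I J" "(\<lambda>_. 1) \<notin> J"
  shows "\<exists>M. maximal_ideal I M \<and> J \<subseteq> M"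
proof -
  define \<A> where "\<A> = {M. poly_ideal I M \<and> J \<subseteq> M \<and> (\<lambda>_. 1) \<notin> M}"
  have "\<exists>M\<in>\<A>. \<forall>X\<in>\<A>. M \<subseteq> X \<longrightarrow> X = M"
  proof (rule subset_Zorn_nonempty)
    show "\<A> \<noteq> {}" using assms by (auto simp: \<A>_def)
  next
    fix C assume C: "C \<noteq> {}" "subset.chain \<A> C"
    have CA: "\<And>M. M \<in> C \<Longrightarrow> poly_ideal I M \<and> J \<subseteq> M \<and> (\<lambda>_. 1) \<notin> M"
      using C(2) by (auto simp: \<A>_def subset_chain_def)
    have "(\<lambda>z. f z + g z) \<in> \<Union>C" if fg: "f \<in> \<Union>C" "g \<in> \<Union>C" for f g
    proof -
      obtain M M' where M: "M \<in> C" "f \<in> M" "M' \<in> C" "g \<in> M'" using fg by blast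
      then have "M \<subseteq> M' \<or> M' \<subseteq> M" using C(2) by (auto simp: subset_chain_def)
      then obtain M'' where "M'' \<in> C" "f \<in> M''" "g \<in> M''" using M by blast
      then show ?thesis using poly_ideal_add CA by blast
    qed
    moreover have "(\<lambda>_. 0) \<in> \<Union>C" using C(1) CA poly_ideal_0 by blast
    moreover have "\<forall>f\<in>\<Union>C. \<forall>q. poly_fun I q \<longrightarrow> (\<lambda>z. q z * f z) \<in> \<Union>C"
      using CA poly_ideal_mult by blast
    moreover have "\<Union>C \<subseteq> Collect (poly_fun I)" using CA poly_ideal_pf by blast
    ultimately have "poly_ideal I (\<Union>C)" unfolding poly_ideal_def by blast
    moreover have "J \<subseteq> \<Union>C" "(\<lambda>_. 1) \<notin> \<Union>C" using C(1) CA by blast+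
    ultimately show "\<Union>C \<in> \<A>" by (simp add: \<A>_def)
  qed
  then obtain M where M: "M \<in> \<A>" "\<forall>X\<in>\<A>. M \<subseteq> X \<longrightarrow> X = M" by blast
  then have "maximal_ideal I M" "J \<subseteq> M"
    unfolding maximal_ideal_def \<A>_def by auto
  then show ?thesis by blast
qed

text \<open>The quotient by \<open>M\<close> is a field: the ideal \<open>M'\<close> generated by
  \<open>M\<close> and \<open>f\<close> is strictly larger than \<open>M\<close>, hence contains
  \<open>1\<close>.\<close>

lemma maximal_ideal_inverse:
  assumes "maximal_ideal I M" "poly_fun I f" "f \<notin> M"
  shows "\<exists>g. poly_fun I g \<and> (\<lambda>z. 1 - g z * f z) \<in> M"
proof -
  have M: "poly_ideal I M" using assms(1) by (simp add: maximal_ideal_def)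
  define M' where "M' = {q. \<exists>m\<in>M. \<exists>g. poly_fun I g \<and> q = (\<lambda>z. m z + g z * f z)}"
  have "poly_ideal I M'"
    unfolding poly_ideal_def
  proof (intro conjI ballI allI impI)
    show "M' \<subseteq> Collect (poly_fun I)"
      using poly_ideal_pf[OF M] assms(2) by (auto simp: M'_def intro!: pf_add pf_mult)
    show "(\<lambda>_. 0) \<in> M'"
      unfolding M'_def using poly_ideal_0[OF M] pf_const[of I 0] by force
  next
    fix q q' assume "q \<in> M'" "q' \<in> M'"
    then obtain m g m' g' where *: "m \<in> M" "poly_fun I g" "q = (\<lambda>z. m z + g z * f z)"
      "m' \<in> M" "poly_fun I g'" "q' = (\<lambda>z. m' z + g' z * f z)" unfolding M'_def by blast
    have "(\<lambda>z. q z + q' z) = (\<lambda>z. (m z + m' z) + (g z + g' z) * f z)"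
      using * by (auto simp: algebra_simps)
    with poly_ideal_add[OF M *(1,4)] pf_add[OF *(2,5)] show "(\<lambda>z. q z + q' z) \<in> M'"
      unfolding M'_def mem_Collect_eq
      by (intro bexI[where x = "\<lambda>z. m z + m' z"] exI[where x = "\<lambda>z. g z + g' z"]) auto
  next
    fix q p assume "q \<in> M'" "poly_fun I p"
    then obtain m g where *: "m \<in> M" "poly_fun I g" "q = (\<lambda>z. m z + g z * f z)"
      unfolding M'_def by blast
    have "(\<lambda>z. p z * q z) = (\<lambda>z. (p z * m z) + (p z * g z) * f z)"
      using * by (auto simp: algebra_simps)
    with poly_ideal_mult[OF M \<open>poly_fun I p\<close> *(1)] pf_mult[OF \<open>poly_fun I p\<close> *(2)]
    show "(\<lambda>z. p z * q z) \<in> M'"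
      unfolding M'_def mem_Collect_eq
      by (intro bexI[where x = "\<lambda>z. p z * m z"] exI[where x = "\<lambda>z. p z * g z"]) auto
  qed
  moreover have "M \<subseteq> M'"
    unfolding M'_def using pf_const[of I 0] by force
  moreover have "f \<in> M'"
    unfolding M'_def using poly_ideal_0[OF M] pf_const[of I 1] by force
  ultimately have "(\<lambda>_. 1) \<in> M'"
    using assms(1,3) unfolding maximal_ideal_def by blast
  then obtain m g where *: "m \<in> M" "poly_fun I g" "(\<lambda>_. 1) = (\<lambda>z. m z + g z * f z)"
    unfolding M'_def by blast
  have "m = (\<lambda>z. 1 - g z * f z)"
  proof
    fix z show "m z = 1 - g z * f z" using fun_cong[OF *(3), of z] by (simp add: eq_diff_eq)
  qed
  then show ?thesis using * by auto
qed

text \<open>With \<open>h\<close> an inverse of \<open>f\<close> modulo \<open>M\<close>, write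
  \<open>g = g * (1 - h * f) + h * (f * g)\<close>.\<close>

lemma maximal_ideal_prime:
  assumes "maximal_ideal I M" "poly_fun I f" "poly_fun I g" "(\<lambda>z. f z * g z) \<in> M" "f \<notin> M"
  shows "g \<in> M"
proof -
  have M: "poly_ideal I M" using assms(1) by (simp add: maximal_ideal_def)
  obtain h where h: "poly_fun I h" "(\<lambda>z. 1 - h z * f z) \<in> M"
    using maximal_ideal_inverse[OF assms(1,2,5)] by blast
  have "(\<lambda>z. g z * (1 - h z * f z) + h z * (f z * g z)) \<in> M"
    using poly_ideal_add[OF M poly_ideal_mult[OF M assms(3) h(2)] poly_ideal_mult[OF M h(1) assms(4)]] .
  then show ?thesis by (simp add: algebra_simps)
qed

text \<open>Over the complex numbers \<open>b\<close> splits: a root is divided out, and primality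
  puts either the linear factor or the cofactor of smaller degree into \<open>M\<close>. A nonzero
  constant cannot be reached, as \<open>M\<close> is proper.\<close>

lemma maximal_ideal_linear_factor:
  fixes b :: "complex poly"
  assumes "maximal_ideal I M" "i \<in> I" "b \<noteq> 0" "(\<lambda>z. poly b (z i)) \<in> M"
  shows "\<exists>r. (\<lambda>z. z i - r) \<in> M"
  using assms(3,4)
proof (induction "degree b" arbitrary: b)
  case 0
  then obtain c where "b = [:c:]" by (metis degree_eq_zeroE)
  then have "(\<lambda>_. 1) \<in> M" using 0 poly_ideal_const[of I M c] assms(1)
    by (auto simp: maximal_ideal_def)
  then show ?case using assms(1) by (simp add: maximal_ideal_def)
next
  case (Suc d)
  have "\<not> constant (poly b)" using Suc.hyps(2) by (simp add: constant_degree)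
  then obtain r where "poly b r = 0" using fundamental_theorem_of_algebra by blast
  then obtain b' where b': "b = [:-r, 1:] * b'" by (metis dvdE poly_eq_0_iff_dvd)
  have b0: "b' \<noteq> 0" using b' Suc.prems by auto
  have "degree b = Suc (degree b')" unfolding b' using b0 by (subst degree_mult_eq) auto
  have pf: "poly_fun I (\<lambda>z. poly p (z i))" for p :: "complex poly"
  proof (induction p)
    case 0
    then show ?case by (simp add: pf_const)
  next
    case (pCons a p)
    then show ?case using assms(2) by (auto intro!: pf_add pf_const pf_mult pf_var)
  qed
  have "(\<lambda>z. (z i - r) * poly b' (z i)) \<in> M"
    using Suc.prems(2) unfolding b' by (simp add: algebra_simps)
  moreover have "poly_fun I (\<lambda>z. z i - r)" using assms(2) by (intro pf_diff pf_const pf_var)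
  ultimately have "(\<lambda>z. z i - r) \<in> M \<or> (\<lambda>z. poly b' (z i)) \<in> M"
    using maximal_ideal_prime[OF assms(1) _ pf[of b']] by blast
  then show ?case
    using Suc.hyps b0 \<open>degree b = Suc (degree b')\<close> by auto
qed

lemma maximal_ideal_coordinate:
  assumes "finite I" "maximal_ideal I M" "i \<in> I"
  shows "\<exists>r. (\<lambda>z. z i - r) \<in> M"
proof (rule ccontr)
  assume none: "\<nexists>r. (\<lambda>z. z i - r) \<in> M"
  have M: "poly_ideal I M" using assms(2) by (simp add: maximal_ideal_def)
  have lin: "poly_fun I (\<lambda>z. z i - c)" for c
    using assms(3) by (intro pf_diff pf_var pf_const)
  have "\<forall>c. \<exists>g. poly_fun I g \<and> (\<lambda>z. 1 - g z * (z i - c)) \<in> M"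
    using maximal_ideal_inverse[OF assms(2) lin] none by blast
  from choice[OF this] obtain g where
    g: "\<And>c. poly_fun I (g c)" "\<And>c. (\<lambda>z. 1 - g c z * (z i - c)) \<in> M" by blast
  have "\<forall>c. \<exists>D. poly_deg I D (g c)" using g(1) unfolding poly_fun_def by blast
  from choice[OF this] obtain D where D: "\<And>c. poly_deg I (D c) (g c)" by blast
  \<comment> \<open>The inverses \<open>g c\<close> form an uncountable family in a space of countable dimension, and a linear
    relation between them puts a nonzero polynomial in \<open>z i\<close> into \<open>M\<close>.\<close>
  have "\<exists>E. infinite {c. D c = E}"
  proof (rule ccontr)
    assume "\<not> ?thesis"
    then have "countable (\<Union>E. {c. D c = E})" by (auto intro: countable_finite)
    moreover have "(\<Union>E. {c. D c = E}) = UNIV" by auto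
    ultimately show False using uncountable_UNIV_complex by simp
  qed
  then obtain E where E: "infinite {c. D c = E}" by blast
  define T where "T = (\<Union>d\<le>E. mono_lists I d)"
  have "finite T" using assms(1) by (simp add: T_def finite_mono_lists)
  \<comment> \<open>One inverse more than \<open>T\<close> has elements, so that a relation between
    them is forced.\<close>
  obtain A where A: "A \<subseteq> {c. D c = E}" "finite A" "card A = Suc (card T)"
    using infinite_arbitrarily_large[OF E] by blast
  have "lin_span UNIV T list_mono (g c)" if "c \<in> A" for c
    unfolding T_def using pd_lin_span[OF assms(1) D[of c]] A(1) that by auto
  then obtain a where a: "\<exists>c\<in>A. a c \<noteq> 0" "\<And>z. (\<Sum>c\<in>A. a c * g c z) = 0"
    using lin_span_dependent[OF \<open>finite T\<close> A(2), of UNIV list_mono g] A(3) by auto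
  \<comment> \<open>Modulo \<open>M\<close> the relation reads: the sum of
    \<open>a c / (z i - c)\<close> is 0. The polynomial \<open>b\<close> is its numerator over the
    common denominator, nonzero because at a point \<open>c\<close> of \<open>A\<close> only the
    term of \<open>c\<close> survives.\<close>
  define b where "b = (\<Sum>c\<in>A. smult (a c) (\<Prod>c'\<in>A - {c}. [:- c', 1:]))"
  have poly_b: "poly b x = (\<Sum>c\<in>A. a c * (\<Prod>c'\<in>A - {c}. x - c'))" for x
    by (simp add: b_def poly_sum poly_prod algebra_simps)
  have "b \<noteq> 0"
  proof -
    obtain c where c: "c \<in> A" "a c \<noteq> 0" using a by blast
    have "(\<Sum>c'\<in>A - {c}. a c' * (\<Prod>c''\<in>A - {c'}. c - c'')) = 0"
      using A(2) c by (intro sum.neutral ballI) (auto intro!: prod_zero)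
    then have "poly b c = a c * (\<Prod>c'\<in>A - {c}. c - c')"
      unfolding poly_b using A(2) c by (simp add: sum.remove)
    also have "\<dots> \<noteq> 0" using c A(2) by (simp add: prod_zero_iff)
    finally show ?thesis by auto
  qed
  moreover have "(\<lambda>z. poly b (z i)) \<in> M"
  proof -
    \<comment> \<open>Expanding this member of \<open>M\<close>, all parts with \<open>g c\<close>
      share the product over the whole of \<open>A\<close> and cancel by the relation
      \<open>a(2)\<close>.\<close>
    have "(\<lambda>z. \<Sum>c\<in>A. (a c * (\<Prod>c'\<in>A - {c}. z i - c')) * (1 - g c z * (z i - c))) \<in> M"
      using g(2) assms(3)
      by (intro poly_ideal_sum[OF M] poly_ideal_mult[OF M] pf_mult pf_prod pf_diff pf_var pf_const) auto
    also have "(\<lambda>z. \<Sum>c\<in>A. (a c * (\<Prod>c'\<in>A - {c}. z i - c')) * (1 - g c z * (z i - c)))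
      = (\<lambda>z. poly b (z i))"
    proof
      fix z
      have "(\<Sum>c\<in>A. (a c * (\<Prod>c'\<in>A - {c}. z i - c')) * (1 - g c z * (z i - c)))
        = poly b (z i) - (\<Sum>c\<in>A. a c * g c z * ((z i - c) * (\<Prod>c'\<in>A - {c}. z i - c')))"
        by (simp add: poly_b algebra_simps sum_subtractf sum.distrib)
      also have "(\<Sum>c\<in>A. a c * g c z * ((z i - c) * (\<Prod>c'\<in>A - {c}. z i - c')))
        = (\<Sum>c\<in>A. a c * g c z * (\<Prod>c'\<in>A. z i - c'))"
        using A(2) by (intro sum.cong refl) (simp add: prod.remove)
      also have "\<dots> = 0" using a(2)[of z] by (simp add: sum_distrib_right[symmetric])
      finally show "(\<Sum>c\<in>A. (a c * (\<Prod>c'\<in>A - {c}. z i - c')) * (1 - g c z * (z i - c)))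
        = poly b (z i)" by simp
    qed
    finally show ?thesis .
  qed
  ultimately show False
    using maximal_ideal_linear_factor[OF assms(2,3)] none by blast
qed

text \<open>A maximal ideal above \<open>J\<close> contains all \<open>z i - r i\<close>, so modulo
  it each polynomial equals its value at \<open>r\<close>. A member of \<open>J\<close> with nonzero
  value at \<open>r\<close> would make that ideal contain a unit.\<close>

theorem weak_nullstellensatz:
  assumes "finite I" "poly_ideal I J" "(\<lambda>_. 1) \<notin> J"
  shows "\<exists>r. \<forall>f\<in>J. f r = 0"
proof -
  obtain M where M: "maximal_ideal I M" "J \<subseteq> M"
    using maximal_ideal_exists[OF assms(2,3)] by blast
  have Mi: "poly_ideal I M" using M(1) by (simp add: maximal_ideal_def)
  obtain r where r: "\<And>i. i \<in> I \<Longrightarrow> (\<lambda>z. z i - r i) \<in> M"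
    using maximal_ideal_coordinate[OF assms(1) M(1)] by metis
  have eval: "(\<lambda>z. f z - f r) \<in> M" if "poly_deg I D f" for D f
    using that
  proof (induction rule: poly_deg.induct)
    case (pd_const D c)
    then show ?case using poly_ideal_0[OF Mi] by simp
  next
    case (pd_add D f g)
    then show ?case using poly_ideal_add[OF Mi pd_add.IH] by (simp add: algebra_simps)
  next
    case (pd_var_mult i D f)
    have "(\<lambda>z. f z * (z i - r i) + r i * (f z - f r)) \<in> M"
      using pd_var_mult r
      by (intro poly_ideal_add[OF Mi] poly_ideal_mult[OF Mi] pf_const) (auto simp: poly_fun_def)
    then show ?case by (simp add: algebra_simps)
  qed
  have "f r = 0" if "f \<in> J" for f
  proof (rule ccontr)
    assume "f r \<noteq> 0"
    have "f \<in> M" using that M(2) by blast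
    then obtain D where "poly_deg I D f" using poly_ideal_pf[OF Mi] poly_fun_def by blast
    then have "(\<lambda>z. (-1) * (f z - f r) + f z) \<in> M"
      using eval \<open>f \<in> M\<close>
      by (intro poly_ideal_add[OF Mi] poly_ideal_mult[OF Mi] pf_const) auto
    then have "(\<lambda>_. f r) \<in> M" by simp
    then have "(\<lambda>_. 1) \<in> M" using poly_ideal_const[OF Mi] \<open>f r \<noteq> 0\<close> by blast
    then show False using M(1) by (simp add: maximal_ideal_def)
  qed
  then show ?thesis by blast
qed

section \<open>Projective closure and the projective Nullstellensatz\<close>

definition cone :: "('i \<Rightarrow> complex) set \<Rightarrow> bool" where
  "cone S \<longleftrightarrow> (\<forall>z\<in>S. \<forall>t. t \<noteq> 0 \<longrightarrow> (\<lambda>i. t * z i) \<in> S)"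

lemma coneD: "cone S \<Longrightarrow> z \<in> S \<Longrightarrow> t \<noteq> 0 \<Longrightarrow> (\<lambda>i. t * z i) \<in> S"
  by (simp add: cone_def)

text \<open>The projective Zariski closure of \<open>S\<close>. Entries outside \<open>I\<close> are
  fixed to 0; for \<open>I = {..N}\<close> the first two conditions together are
  \<open>pvec N r\<close>.\<close>

definition hom_closure :: "'i set \<Rightarrow> ('i \<Rightarrow> complex) set \<Rightarrow> ('i \<Rightarrow> complex) set" where
  "hom_closure I S = {r. (\<exists>i\<in>I. r i \<noteq> 0) \<and> (\<forall>i. i \<notin> I \<longrightarrow> r i = 0) \<and>
     (\<forall>d h. hom_fun I d h \<longrightarrow> (\<forall>z\<in>S. h z = 0) \<longrightarrow> h r = 0)}"

text \<open>Work in the chart \<open>z i = 1\<close>: there \<open>J\<close> is the ideal generated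
  by the \<open>F k\<close> modulo functions vanishing on the chart of \<open>S\<close>. A zero of
  \<open>J\<close> would be a common zero of the \<open>F k\<close> in the closure, so
  \<open>1\<close> lies in \<open>J\<close>, and homogenising its representation gives a power of
  \<open>z i\<close>.\<close>

lemma projective_nullstellensatz_coordinate:
  assumes "finite I" "cone S" "finite K"
    and F: "\<And>k. k \<in> K \<Longrightarrow> hom_fun I 1 (F k)"
    and nz: "\<not> (\<exists>r\<in>hom_closure I S. \<forall>k\<in>K. F k r = 0)"
    and i: "i \<in> I"
  shows "\<exists>D g. (\<forall>k\<in>K. hom_fun I D (g k)) \<and> (\<forall>z\<in>S. z i ^ Suc D = (\<Sum>k\<in>K. F k z * g k z))"
proof -
  define J where "J = {f. poly_fun I f \<and> (\<exists>g. (\<forall>k\<in>K. poly_fun I (g k)) \<and>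
    (\<forall>z\<in>S. z i = 1 \<longrightarrow> f z = (\<Sum>k\<in>K. F k z * g k z)))}"
  have "poly_ideal I J"
    unfolding poly_ideal_def
  proof (intro conjI ballI allI impI)
    show "J \<subseteq> Collect (poly_fun I)" by (auto simp: J_def)
    show "(\<lambda>_. 0) \<in> J"
      by (auto simp: J_def pf_const intro!: exI[of _ "\<lambda>_ _. 0"])
  next
    fix f f' assume "f \<in> J" "f' \<in> J"
    then obtain g g' where "poly_fun I f" "poly_fun I f'" "\<forall>k\<in>K. poly_fun I (g k)" "\<forall>k\<in>K. poly_fun I (g' k)"
      "\<forall>z\<in>S. z i = 1 \<longrightarrow> f z = (\<Sum>k\<in>K. F k z * g k z)"
      "\<forall>z\<in>S. z i = 1 \<longrightarrow> f' z = (\<Sum>k\<in>K. F k z * g' k z)" unfolding J_def by blast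
    then show "(\<lambda>z. f z + f' z) \<in> J"
      by (auto simp: J_def sum.distrib algebra_simps intro!: pf_add exI[of _ "\<lambda>k z. g k z + g' k z"])
  next
    fix f q assume "f \<in> J" "poly_fun I q"
    then obtain g where "poly_fun I f" "\<forall>k\<in>K. poly_fun I (g k)"
      "\<forall>z\<in>S. z i = 1 \<longrightarrow> f z = (\<Sum>k\<in>K. F k z * g k z)" unfolding J_def by blast
    then show "(\<lambda>z. q z * f z) \<in> J" using \<open>poly_fun I q\<close>
      by (auto simp: J_def sum_distrib_left algebra_simps intro!: pf_mult exI[of _ "\<lambda>k z. q z * g k z"])
  qed
  moreover have "\<exists>r\<in>hom_closure I S. \<forall>k\<in>K. F k r = 0" if zero: "\<forall>f\<in>J. f r = 0" for r
  proof -
    \<comment> \<open>Polynomials over \<open>I\<close> do not see the other coordinates, but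
      membership in \<open>hom_closure\<close> requires them to be 0.\<close>
    define r' where "r' j = (if j \<in> I then r j else 0)" for j
    have eq: "h r' = h r" if "hom_fun I d h" for d h
      using that by (rule hom_eval_cong) (simp add: r'_def)
    have in_J: "h \<in> J" if "hom_fun I d h" "\<forall>z\<in>S. z i = 1 \<longrightarrow> h z = 0" for d h
      using that by (auto simp: J_def hom_imp_pf pf_const intro!: exI[of _ "\<lambda>_ _. 0"])
    have "(\<lambda>z. z i - 1) \<in> J"
      using i by (auto simp: J_def pf_const intro!: pf_diff pf_var exI[of _ "\<lambda>_ _. 0"])
    then have "r i = 1" using zero by fastforce
    have "F k \<in> J" if "k \<in> K" for k
    proof -
      have "F k z = (\<Sum>k'\<in>K. F k' z * (if k' = k then 1 else 0))" for z
        using that assms(3) by (simp add: if_distrib cong: if_cong)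
      then show ?thesis using hom_imp_pf[OF F[OF that]]
        by (auto simp: J_def pf_const intro!: exI[of _ "\<lambda>k' z. if k' = k then 1 else 0"])
    qed
    then have "\<forall>k\<in>K. F k r' = 0" using zero eq[OF F] by auto
    moreover have "r' \<in> hom_closure I S"
      unfolding hom_closure_def
    proof (intro CollectI conjI allI impI)
      show "\<exists>i\<in>I. r' i \<noteq> 0" using i \<open>r i = 1\<close> by (auto simp: r'_def intro!: bexI[of _ i])
      show "r' j = 0" if "j \<notin> I" for j using that by (simp add: r'_def)
      show "h r' = 0" if "hom_fun I d h" "\<forall>z\<in>S. h z = 0" for d h
        using in_J[OF that(1)] that(2) zero eq[OF that(1)] by simp
    qed
    ultimately show ?thesis by blast
  qed
  ultimately have "(\<lambda>_. 1) \<in> J"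
    using weak_nullstellensatz[OF assms(1)] nz by blast
  then obtain g where g: "\<And>k. k \<in> K \<Longrightarrow> poly_fun I (g k)"
    "\<And>z. z \<in> S \<Longrightarrow> z i = 1 \<Longrightarrow> 1 = (\<Sum>k\<in>K. F k z * g k z)" unfolding J_def by blast
  obtain D where "\<And>k. k \<in> K \<Longrightarrow> poly_deg I D (g k)"
    using pf_uniform_degree[OF assms(3), of I g] g(1) by blast
  then have "\<forall>k\<in>K. \<exists>h. hom_fun I D h \<and> (\<forall>z. z i \<noteq> 0 \<longrightarrow> h z = z i ^ D * g k (\<lambda>j. z j / z i))"
    using pd_homogenize[OF _ i] by blast
  from bchoice[OF this] obtain h where h: "\<And>k. k \<in> K \<Longrightarrow> hom_fun I D (h k)"
    "\<And>k z. k \<in> K \<Longrightarrow> z i \<noteq> 0 \<Longrightarrow> h k z = z i ^ D * g k (\<lambda>j. z j / z i)" by blast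
  \<comment> \<open>Homogenisation controls only the points with \<open>z i \<noteq> 0\<close>. One
    more factor \<open>z i\<close> on both sides makes the identity hold trivially where
    \<open>z i = 0\<close>.\<close>
  have "z i ^ Suc (Suc D) = (\<Sum>k\<in>K. F k z * (z i * h k z))" if "z \<in> S" for z
  proof (cases "z i = 0")
    case False
    have "(\<lambda>j. z j / z i) = (\<lambda>j. (1 / z i) * z j)" by auto
    moreover have "(\<lambda>j. (1 / z i) * z j) \<in> S" by (rule coneD) (use assms(2) that False in auto)
    ultimately have "(\<lambda>j. z j / z i) \<in> S" by simp
    from g(2)[OF this] False have "1 = (\<Sum>k\<in>K. F k (\<lambda>j. z j / z i) * g k (\<lambda>j. z j / z i))" by simp
    then have "z i ^ Suc D = (\<Sum>k\<in>K. (z i * F k (\<lambda>j. z j / z i)) * (z i ^ D * g k (\<lambda>j. z j / z i)))"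
      by (simp add: sum_distrib_left[symmetric] algebra_simps)
    also have "\<dots> = (\<Sum>k\<in>K. F k z * h k z)"
    proof (intro sum.cong refl)
      fix k assume "k \<in> K"
      have "F k z = z i * F k (\<lambda>j. z j / z i)"
        using hom_eval_scale[OF F[OF \<open>k \<in> K\<close>], of "z i" "\<lambda>j. z j / z i"] False by simp
      then show "z i * F k (\<lambda>j. z j / z i) * (z i ^ D * g k (\<lambda>j. z j / z i)) = F k z * h k z"
        using h(2)[of k z] \<open>k \<in> K\<close> False by simp
    qed
    finally show ?thesis by (simp add: sum_distrib_left algebra_simps)
  qed auto
  moreover have "\<forall>k\<in>K. hom_fun I (Suc D) (\<lambda>z. z i * h k z)"
    using h(1) i by (auto intro: hom_var_mult)
  ultimately show ?thesis
    by (intro exI[where x = "Suc D"] exI[where x = "\<lambda>k z. z i * h k z"] conjI ballI) auto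
qed

subsection \<open>Common zeros of linear forms\<close>

lemma list_mono_filter:
  "list_mono xs z = z i ^ count_list xs i * list_mono (filter (\<lambda>x. x \<noteq> i) xs) z"
  by (induction xs) (auto simp: list_mono_def)

lemma length_count_filter: "length xs = count_list xs i + length (filter (\<lambda>x. x \<noteq> i) xs)"
  by (induction xs) auto

text \<open>A monomial of large degree contains a high power of some variable, and on
  \<open>S\<close> such a power is a combination of the \<open>F k\<close>. Hence all forms of large
  degree are such combinations, with cofactors of one degree less.\<close>

lemma hom_reduction:
  assumes "finite I" "cone S" "finite K"
    and F: "\<And>k. k \<in> K \<Longrightarrow> hom_fun I 1 (F k)"
    and nz: "\<not> (\<exists>r\<in>hom_closure I S. \<forall>k\<in>K. F k r = 0)"
  shows "\<exists>d0. \<forall>d\<ge>d0. \<forall>f. hom_fun I (Suc d) f \<longrightarrow>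
    (\<exists>g. (\<forall>k\<in>K. hom_fun I d (g k)) \<and> (\<forall>z\<in>S. f z = (\<Sum>k\<in>K. F k z * g k z)))"
proof -
  have "\<forall>i\<in>I. \<exists>D g. (\<forall>k\<in>K. hom_fun I D (g k)) \<and>
      (\<forall>z\<in>S. z i ^ Suc D = (\<Sum>k\<in>K. F k z * g k z))"
    using projective_nullstellensatz_coordinate[OF assms(1-3) F nz] by blast
  from bchoice[OF this] obtain D where "\<forall>i\<in>I. \<exists>g. (\<forall>k\<in>K. hom_fun I (D i) (g k)) \<and>
      (\<forall>z\<in>S. z i ^ Suc (D i) = (\<Sum>k\<in>K. F k z * g k z))" by blast
  from bchoice[OF this] obtain g where g: "\<And>i k. i \<in> I \<Longrightarrow> k \<in> K \<Longrightarrow> hom_fun I (D i) (g i k)"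
    "\<And>i z. i \<in> I \<Longrightarrow> z \<in> S \<Longrightarrow> z i ^ Suc (D i) = (\<Sum>k\<in>K. F k z * g i k z)" by blast
  \<comment> \<open>A common upper bound for the exponents \<open>D i\<close>.\<close>
  define E where "E = (\<Sum>i\<in>I. D i)"
  define red where "red d f \<longleftrightarrow> (\<exists>g. (\<forall>k\<in>K. hom_fun I d (g k)) \<and> (\<forall>z\<in>S. f z = (\<Sum>k\<in>K. F k z * g k z)))"
    for d f
  have red_scale: "red d (\<lambda>z. c * f z)" if r: "red d f" for d c f
  proof -
    obtain g where "\<forall>k\<in>K. hom_fun I d (g k)" "\<forall>z\<in>S. f z = (\<Sum>k\<in>K. F k z * g k z)"
      using r unfolding red_def by blast
    then show ?thesis unfolding red_def
      by (intro exI[of _ "\<lambda>k z. c * g k z"]) (auto simp: sum_distrib_left algebra_simps intro: hom_scale)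
  qed
  have red_add: "red d (\<lambda>z. f z + f' z)" if r: "red d f" "red d f'" for d f f'
  proof -
    obtain g g' where "\<forall>k\<in>K. hom_fun I d (g k)" "\<forall>z\<in>S. f z = (\<Sum>k\<in>K. F k z * g k z)"
      "\<forall>k\<in>K. hom_fun I d (g' k)" "\<forall>z\<in>S. f' z = (\<Sum>k\<in>K. F k z * g' k z)"
      using r unfolding red_def by blast
    then show ?thesis unfolding red_def
      by (intro exI[of _ "\<lambda>k z. g k z + g' k z"]) (auto simp: sum.distrib algebra_simps intro: hom_add)
  qed
  have red_0: "red d (\<lambda>z. 0)" for d
    unfolding red_def by (intro exI[of _ "\<lambda>k z. 0"]) (auto intro: hom_zero)
  have red_sum: "red d (\<lambda>z. \<Sum>a\<in>A. f a z)" if "\<And>a. a \<in> A \<Longrightarrow> red d (f a)" for d A and f :: "'i list \<Rightarrow> _"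
    using that by (induction A rule: infinite_finite_induct) (auto intro: red_0 red_add)
  have red_mono: "red d (list_mono xs)" if xs: "xs \<in> mono_lists I (Suc d)" and d: "d \<ge> card I * E" for d xs
  proof -
    \<comment> \<open>Pigeonhole: if each variable occurred at most \<open>E\<close> times, the
      length \<open>Suc d\<close> would be at most \<open>card I * E\<close>.\<close>
    have "\<exists>i\<in>I. count_list xs i \<ge> Suc E"
    proof (rule ccontr)
      assume "\<not> ?thesis"
      then have "sum (count_list xs) I \<le> card I * E"
        using sum_bounded_above[of I "count_list xs" E] by (force simp: not_less_eq_eq)
      moreover have "sum (count_list xs) I = Suc d"
        using sum_count_set[of xs I] xs assms(1) by (auto simp: mono_lists_def)
      ultimately show False using d by simp
    qed
    then obtain i where i: "i \<in> I" "count_list xs i \<ge> Suc E" by blast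
    have "D i \<le> E" using i(1) assms(1) unfolding E_def by (simp add: member_le_sum)
    define e where "e = count_list xs i - Suc (D i)"
    define ys where "ys = filter (\<lambda>x. x \<noteq> i) xs"
    have e: "count_list xs i = Suc (D i) + e" using i \<open>D i \<le> E\<close> by (simp add: e_def)
    have ys: "set ys \<subseteq> I" "D i + (e + length ys) = d"
      using xs length_count_filter[of xs i] e by (auto simp: ys_def mono_lists_def)
    have "list_mono xs z = (\<Sum>k\<in>K. F k z * (g i k z * (z i ^ e * list_mono ys z)))" if "z \<in> S" for z
    proof -
      have "list_mono xs z = z i ^ Suc (D i) * (z i ^ e * list_mono ys z)"
        unfolding list_mono_filter[of xs z i] e power_add ys_def by (simp only: mult.assoc)
      also have "\<dots> = (\<Sum>k\<in>K. F k z * g i k z) * (z i ^ e * list_mono ys z)"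
        by (simp only: g(2)[OF i(1) that])
      finally show ?thesis by (simp add: sum_distrib_right mult.assoc)
    qed
    moreover have "hom_fun I d (\<lambda>z. g i k z * (z i ^ e * list_mono ys z))" if "k \<in> K" for k
      using hom_mult[OF g(1)[OF i(1) that] hom_mult[OF hom_var_power[OF i(1), of e] hom_list_mono[OF ys(1)]]] ys(2)
      by simp
    ultimately show ?thesis unfolding red_def
      by (intro exI[where x = "\<lambda>k z. g i k z * (z i ^ e * list_mono ys z)"]) blast
  qed
  have "red d f" if f: "hom_fun I (Suc d) f" and d: "d \<ge> card I * E" for d f
  proof -
    obtain c where "f = (\<lambda>z. \<Sum>xs\<in>mono_lists I (Suc d). c xs * list_mono xs z)"
      using hom_lin_span[OF assms(1) f] unfolding lin_span_def by auto
    moreover have "red d (\<lambda>z. \<Sum>xs\<in>mono_lists I (Suc d). c xs * list_mono xs z)"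
      using red_mono d by (intro red_sum red_scale) auto
    ultimately show ?thesis by simp
  qed
  then show ?thesis unfolding red_def by blast
qed

text \<open>If the linear forms \<open>F k\<close> have no common zero on \<open>S\<close>, then the coordinate ring of \<open>S\<close> is a finite
  module over the ring they generate, so its Hilbert function grows at most like that ring's.\<close>

lemma hom_lin_span_forms:
  assumes "finite I" "cone S" "finite K"
    and F: "\<And>k. k \<in> K \<Longrightarrow> hom_fun I 1 (F k)"
    and nz: "\<not> (\<exists>r\<in>hom_closure I S. \<forall>k\<in>K. F k r = 0)"
  shows "\<exists>B. finite B \<and> (\<forall>D f. poly_deg I D f \<longrightarrow>
    lin_span S ((K \<rightarrow>\<^sub>E {..D}) \<times> B) (\<lambda>(a, xs) z. (\<Prod>k\<in>K. F k z ^ a k) * list_mono xs z) f)"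
proof -
  obtain d0 where d0: "\<And>d f. d \<ge> d0 \<Longrightarrow> hom_fun I (Suc d) f \<Longrightarrow>
    \<exists>g. (\<forall>k\<in>K. hom_fun I d (g k)) \<and> (\<forall>z\<in>S. f z = (\<Sum>k\<in>K. F k z * g k z))"
    using hom_reduction[OF assms] by blast
  \<comment> \<open>The module generators: all monomials of degree at most \<open>d0\<close>, below
    which no reduction is available.\<close>
  define B where "B = (\<Union>d\<le>d0. mono_lists I d)"
  define G where "G = (\<lambda>(a, xs) z. (\<Prod>k\<in>K. F k z ^ a k) * list_mono xs z)"
  define T where "T d = (K \<rightarrow>\<^sub>E {..d}) \<times> B" for d :: nat
  have finB: "finite B" unfolding B_def using finite_mono_lists[OF assms(1)] by auto
  have finT: "finite (T d)" for d unfolding T_def using finB assms(3) by (auto intro: finite_PiE)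
  have T_mono: "T d \<subseteq> T e" if "d \<le> e" for d e
    unfolding T_def using that by (intro Sigma_mono PiE_mono) auto
  have small: "lin_span S (T d) G f" if f: "hom_fun I d f" and d: "d \<le> d0" for d f
  proof (rule lin_span_trans)
    show "lin_span S (mono_lists I d) list_mono f"
      using hom_lin_span[OF assms(1) f] unfolding lin_span_def by auto
  next
    fix xs assume "xs \<in> mono_lists I d"
    then have "((\<lambda>k\<in>K. 0), xs) \<in> T d" using d by (auto simp: T_def B_def)
    from lin_span_base[OF finT this, of S G] show "lin_span S (T d) G (list_mono xs)"
      by (simp add: G_def)
  qed
  \<comment> \<open>Induction on the degree: above \<open>d0\<close> a form is a combination of the
    \<open>F k\<close> with cofactors of degree one less, and multiplying by \<open>F k\<close>
    raises one exponent by one. The exponents thus never exceed the degree.\<close>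
  have hom: "lin_span S (T d) G f" if "hom_fun I d f" for d f
    using that
  proof (induction d arbitrary: f)
    case 0
    then show ?case using small by simp
  next
    case (Suc d)
    show ?case
    proof (cases "Suc d \<le> d0")
      case True
      then show ?thesis using small Suc.prems by blast
    next
      case False
      then obtain g where g: "\<And>k. k \<in> K \<Longrightarrow> hom_fun I d (g k)"
        "\<And>z. z \<in> S \<Longrightarrow> f z = (\<Sum>k\<in>K. F k z * g k z)"
        using d0[of d f] Suc.prems by force
      have "lin_span S (T (Suc d)) G (\<lambda>z. F k z * g k z)" if k: "k \<in> K" for k
      proof (rule lin_span_mult[OF Suc.IH[OF g(1)[OF k]]])
        fix t assume "t \<in> T d"
        then obtain a xs where t: "t = (a, xs)" "a \<in> K \<rightarrow>\<^sub>E {..d}" "xs \<in> B" unfolding T_def by blast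
        have "(a(k := Suc (a k)), xs) \<in> T (Suc d)"
          using t k by (auto simp: T_def PiE_iff extensional_def Pi_iff)
        moreover have "G (a(k := Suc (a k)), xs) = (\<lambda>z. F k z * G t z)"
        proof
          fix z
          have "(\<Prod>j\<in>K. F j z ^ (a(k := Suc (a k))) j) = F k z * (\<Prod>j\<in>K. F j z ^ a j)"
            using k assms(3) by (simp add: prod.remove[of K k] mult.assoc)
          then show "G (a(k := Suc (a k)), xs) z = F k z * G t z" by (simp add: G_def t(1))
        qed
        ultimately show "lin_span S (T (Suc d)) G (\<lambda>z. F k z * G t z)"
          using lin_span_base[OF finT] by metis
      qed
      then have "lin_span S (T (Suc d)) G (\<lambda>z. \<Sum>k\<in>K. F k z * g k z)" by (rule lin_span_sum)
      then show ?thesis by (subst lin_span_cong[of S f "\<lambda>z. \<Sum>k\<in>K. F k z * g k z", OF g(2)])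
    qed
  qed
  have "lin_span S (T D) G f" if f: "poly_deg I D f" for D f
  proof -
    obtain h where h: "\<forall>d. hom_fun I d (h d)" "f = (\<lambda>z. \<Sum>d\<le>D. h d z)"
      using pd_decompose[OF f] by blast
    show ?thesis unfolding h(2)
      using h(1) hom T_mono finT by (intro lin_span_sum) (blast intro: lin_span_mono)
  qed
  then show ?thesis using finB unfolding T_def G_def by blast
qed

text \<open>Concerns the \<open>k + 1\<close> functions \<open>u 0\<close>, ..., \<open>u k\<close>
  restricted to \<open>S\<close>. Relations are indexed by a box of exponents, not by total degree,
  because boxes are easy to count and to split off variable by variable.\<close>

definition alg_indep :: "'p set \<Rightarrow> nat \<Rightarrow> (nat \<Rightarrow> 'p \<Rightarrow> complex) \<Rightarrow> bool" where
  "alg_indep S k u \<longleftrightarrow> (\<forall>s c. (\<forall>z\<in>S. (\<Sum>a\<in>{..k} \<rightarrow>\<^sub>E {..s}. c a * (\<Prod>j\<le>k. u j z ^ a j)) = 0)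
     \<longrightarrow> (\<forall>a\<in>{..k} \<rightarrow>\<^sub>E {..s::nat}. c a = 0))"

lemma alg_indep_mono: "alg_indep S k u \<Longrightarrow> S \<subseteq> S' \<Longrightarrow> alg_indep S' k u"
  unfolding alg_indep_def by blast

text \<open>Without a common zero, the \<open>(s + 1) ^ (n + 1)\<close> monomials in the
  \<open>u j\<close>, where \<open>n = card K\<close>, would lie in a space whose dimension grows
  only like \<open>s ^ n\<close>. For large \<open>s\<close> this contradicts independence.\<close>

theorem common_zero_of_linear_forms:
  assumes "finite I" "cone S" "finite K"
    and F: "\<And>k. k \<in> K \<Longrightarrow> hom_fun I 1 (F k)"
    and u: "\<And>j. j \<le> card K \<Longrightarrow> poly_fun I (u j)"
    and indep: "alg_indep S (card K) u"
  shows "\<exists>r\<in>hom_closure I S. \<forall>k\<in>K. F k r = 0"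
proof (rule ccontr)
  assume "\<not> ?thesis"
  then have "\<exists>B. finite B \<and> (\<forall>D f. poly_deg I D f \<longrightarrow>
      lin_span S ((K \<rightarrow>\<^sub>E {..D}) \<times> B) (\<lambda>(a, xs) z. (\<Prod>k\<in>K. F k z ^ a k) * list_mono xs z) f)"
    by (intro hom_lin_span_forms[OF assms(1-3) F])
  then obtain B where B: "finite B" "\<forall>D f. poly_deg I D f \<longrightarrow>
      lin_span S ((K \<rightarrow>\<^sub>E {..D}) \<times> B) (\<lambda>(a, xs) z. (\<Prod>k\<in>K. F k z ^ a k) * list_mono xs z) f"
    by (elim exE conjE)
  define n where "n = card K"
  obtain E where E: "\<And>j. j \<le> n \<Longrightarrow> poly_deg I E (u j)"
    using pf_uniform_degree[of "{..n}" I u] u by (auto simp: n_def)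
  \<comment> \<open>\<open>M\<close> ensures \<open>Suc D \<le> M * Suc s\<close>. With
    \<open>s = M ^ n * card B\<close> the spanning set then has at most \<open>Suc s ^ n * s\<close>
    elements, fewer than the \<open>Suc s ^ Suc n\<close> monomials.\<close>
  define M where "M = Suc n * E + 1"
  define s where "s = M ^ n * card B"
  define D where "D = Suc n * (s * E)"
  define A where "A = {..n} \<rightarrow>\<^sub>E {..s}"
  have "poly_deg I D (\<lambda>z. \<Prod>j\<le>n. u j z ^ a j)" if "a \<in> A" for a
  proof -
    have "poly_deg I (card {..n} * (s * E)) (\<lambda>z. \<Prod>j\<le>n. u j z ^ a j)"
    proof (rule pd_prod)
      fix j assume j: "j \<in> {..n}"
      then have "a j \<le> s" using that unfolding A_def by (auto simp: PiE_iff)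
      then show "poly_deg I (s * E) (\<lambda>z. u j z ^ a j)"
        using pd_mono[OF pd_power[OF E]] j by auto
    qed simp
    then show ?thesis by (simp add: D_def)
  qed
  note deg = this
  have span: "lin_span S ((K \<rightarrow>\<^sub>E {..D}) \<times> B) (\<lambda>(a, xs) z. (\<Prod>k\<in>K. F k z ^ a k) * list_mono xs z)
    (\<lambda>z. \<Prod>j\<le>n. u j z ^ a j)" if "a \<in> A" for a
    by (rule B(2)[rule_format]) (rule deg[OF that])
  have "card ((K \<rightarrow>\<^sub>E {..D}) \<times> B) = Suc D ^ n * card B"
    using assms(3) by (simp add: card_cartesian_product card_funcsetE n_def)
  also have "\<dots> \<le> (M * Suc s) ^ n * card B"
    by (intro mult_right_mono power_mono) (auto simp: M_def D_def algebra_simps)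
  also have "\<dots> = Suc s ^ n * s" by (simp only: power_mult_distrib s_def ac_simps)
  also have "\<dots> < Suc s ^ Suc n" by simp
  also have "\<dots> = card A" by (simp add: A_def card_funcsetE)
  finally have "card ((K \<rightarrow>\<^sub>E {..D}) \<times> B) < card A" .
  moreover have "finite A" "finite ((K \<rightarrow>\<^sub>E {..D}) \<times> B)"
    using B(1) assms(3) by (auto simp: A_def intro!: finite_PiE)
  ultimately have "\<exists>c. (\<exists>a\<in>A. c a \<noteq> 0) \<and> (\<forall>z\<in>S. (\<Sum>a\<in>A. c a * (\<Prod>j\<le>n. u j z ^ a j)) = 0)"
    by (intro lin_span_dependent[OF _ _ _ span])
  then show False using indep unfolding alg_indep_def A_def n_def by blast
qed

section \<open>Algebraic independence tested on infinite grids\<close>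

lemma sum_PiE_Suc:
  fixes v :: "nat \<Rightarrow> complex"
  shows "(\<Sum>a\<in>{..Suc k} \<rightarrow>\<^sub>E {..s}. c a * (\<Prod>j\<le>Suc k. v j ^ a j)) =
    (\<Sum>y\<le>s. (\<Sum>a\<in>{..k} \<rightarrow>\<^sub>E {..s}. c (a(Suc k := y)) * (\<Prod>j\<le>k. v j ^ a j)) * v (Suc k) ^ y)"
proof -
  let ?g = "\<lambda>(y, a). a(Suc k := y)"
  have "inj_on ?g ({..s} \<times> ({..k} \<rightarrow>\<^sub>E {..s}))"
    using inj_combinator[of "Suc k" "{..k}" "\<lambda>_. {..s}"] by simp
  moreover have "{..Suc k} \<rightarrow>\<^sub>E {..s} = ?g ` ({..s} \<times> ({..k} \<rightarrow>\<^sub>E {..s}))"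
    unfolding atMost_Suc PiE_insert_eq by simp
  ultimately have "(\<Sum>a\<in>{..Suc k} \<rightarrow>\<^sub>E {..s}. c a * (\<Prod>j\<le>Suc k. v j ^ a j)) =
    (\<Sum>(y, a)\<in>{..s} \<times> ({..k} \<rightarrow>\<^sub>E {..s}). c (a(Suc k := y)) * (\<Prod>j\<le>Suc k. v j ^ (a(Suc k := y)) j))"
    by (intro sum.reindex_cong[of ?g]) (simp_all only: case_prod_beta)
  also have "\<dots> = (\<Sum>y\<le>s. \<Sum>a\<in>{..k} \<rightarrow>\<^sub>E {..s}. c (a(Suc k := y)) * (\<Prod>j\<le>Suc k. v j ^ (a(Suc k := y)) j))"
    by (simp add: sum.cartesian_product)
  also have "\<dots> = (\<Sum>y\<le>s. (\<Sum>a\<in>{..k} \<rightarrow>\<^sub>E {..s}. c (a(Suc k := y)) * (\<Prod>j\<le>k. v j ^ a j)) * v (Suc k) ^ y)"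
  proof (intro sum.cong refl)
    fix y
    have "(\<Prod>j\<le>k. v j ^ (a(Suc k := y)) j) = (\<Prod>j\<le>k. v j ^ a j)" for a
      by (intro prod.cong) auto
    then show "(\<Sum>a\<in>{..k} \<rightarrow>\<^sub>E {..s}. c (a(Suc k := y)) * (\<Prod>j\<le>Suc k. v j ^ (a(Suc k := y)) j)) =
      (\<Sum>a\<in>{..k} \<rightarrow>\<^sub>E {..s}. c (a(Suc k := y)) * (\<Prod>j\<le>k. v j ^ a j)) * v (Suc k) ^ y"
      by (simp add: sum_distrib_right mult.assoc)
  qed
  finally show ?thesis .
qed

lemma polyfun_zero_on_infinite:
  fixes c :: "nat \<Rightarrow> complex"
  assumes "infinite A" "\<And>x. x \<in> A \<Longrightarrow> (\<Sum>i\<le>n. c i * x ^ i) = 0" "i \<le> n"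
  shows "c i = 0"
proof -
  have "A \<subseteq> {x. (\<Sum>i\<le>n. c i * x ^ i) = 0}" using assms(2) by auto
  then have "infinite {x. (\<Sum>i\<le>n. c i * x ^ i) = 0}" using assms(1) finite_subset by blast
  then show ?thesis using assms(3) by (auto simp: polyfun_finite_roots)
qed

lemma infinite_nonzero_complex: "infinite {t::complex. t \<noteq> 0}"
  using infinite_UNIV_char_0[where 'a = complex] by (simp add: Collect_neg_eq)

lemma sum_PiE_atMost_0:
  fixes v :: "nat \<Rightarrow> complex"
  shows "(\<Sum>a\<in>{..0::nat} \<rightarrow>\<^sub>E {..s}. c a * (\<Prod>j\<le>0. v j ^ a j)) =
    (\<Sum>y\<le>s. c ((\<lambda>_. undefined)(0 := y)) * v 0 ^ y)"
proof -
  have "{..0::nat} \<rightarrow>\<^sub>E {..s} = (\<lambda>y. (\<lambda>_. undefined)(0 := y)) ` {..s}"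
    by (auto simp: PiE_insert_eq)
  moreover have "inj_on (\<lambda>y. (\<lambda>_. undefined)(0 := y)) {..s}"
    by (auto simp: inj_on_def fun_eq_iff)
  ultimately show ?thesis by (intro sum.reindex_cong) auto
qed

text \<open>A polynomial vanishing on a product of infinite sets is zero, one variable at a time.
  The values have the form \<open>t\<close>, \<open>t * l i\<close> because on a cone one prescribes
  ratios and then rescales by \<open>t\<close>.\<close>

lemma alg_indep_grid:
  fixes L :: "nat \<Rightarrow> complex set"
  assumes inf: "\<And>i. infinite (L i)"
    and grid: "\<And>t l. t \<noteq> 0 \<Longrightarrow> (\<And>i. l i \<in> L i) \<Longrightarrow>
       \<exists>z\<in>S. u 0 z = t \<and> (\<forall>i\<in>{1..k}. u i z = t * l i)"
  shows "alg_indep S k u"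
proof -
  have main: "\<forall>a\<in>{..m} \<rightarrow>\<^sub>E {..s}. c a = 0"
    if "\<And>t l. t \<noteq> 0 \<Longrightarrow> (\<And>i. l i \<in> L i) \<Longrightarrow>
      (\<Sum>a\<in>{..m} \<rightarrow>\<^sub>E {..s}. c a * (\<Prod>j\<le>m. (if j = 0 then t else t * l j) ^ a j)) = 0" for m s c
    using that
  proof (induction m arbitrary: c)
    case 0
    have "\<forall>i. \<exists>x. x \<in> L i" using inf infinite_imp_nonempty by blast
    then obtain l where "\<And>i. l i \<in> L i" by metis
    then have "(\<Sum>y\<le>s. c ((\<lambda>_. undefined)(0 := y)) * t ^ y) = 0" if "t \<noteq> 0" for t
      using 0[OF that, of l] unfolding sum_PiE_atMost_0 by simp
    then have "\<And>y. y \<le> s \<Longrightarrow> c ((\<lambda>_. undefined)(0 := y)) = 0"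
      using polyfun_zero_on_infinite[OF infinite_nonzero_complex, where n = s and c = "\<lambda>y. c ((\<lambda>_. undefined)(0 := y))"] by auto
    then show ?case by (auto simp: PiE_insert_eq)
  next
    case (Suc m)
    have *: "(\<Sum>a\<in>{..m} \<rightarrow>\<^sub>E {..s}. c (a(Suc m := y)) * (\<Prod>j\<le>m. (if j = 0 then t else t * l j) ^ a j)) = 0"
      if t: "t \<noteq> 0" and l: "\<And>i. l i \<in> L i" and y: "y \<le> s" for t l y
    proof (rule polyfun_zero_on_infinite[OF _ _ y])
      show "infinite ((*) t ` L (Suc m))"
        using inf t by (subst finite_image_iff) (auto simp: inj_on_def)
      fix x assume "x \<in> (*) t ` L (Suc m)"
      then obtain w where w: "w \<in> L (Suc m)" "x = t * w" by blast
      \<comment> \<open>Only the last grid coordinate moves. As \<open>w\<close> runs through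
        \<open>L (Suc m)\<close> the last variable takes infinitely many values, so each coefficient
        with respect to it vanishes.\<close>
      define l' where "l' = l(Suc m := w)"
      have l': "\<And>i. l' i \<in> L i" using l w by (auto simp: l'_def)
      have "(\<Prod>j\<le>m. (if j = 0 then t else t * l' j) ^ a j) = (\<Prod>j\<le>m. (if j = 0 then t else t * l j) ^ a j)"
        for a :: "nat \<Rightarrow> nat" by (intro prod.cong) (auto simp: l'_def)
      then show "(\<Sum>y\<le>s. (\<Sum>a\<in>{..m} \<rightarrow>\<^sub>E {..s}. c (a(Suc m := y)) *
          (\<Prod>j\<le>m. (if j = 0 then t else t * l j) ^ a j)) * x ^ y) = 0"
        using Suc.prems[OF t, of l', OF l'] unfolding sum_PiE_Suc by (simp add: l'_def w(2))
    qed
    have "c (a(Suc m := y)) = 0" if "a \<in> {..m} \<rightarrow>\<^sub>E {..s}" "y \<le> s" for a y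
      using Suc.IH[of "\<lambda>a. c (a(Suc m := y))"] * that by blast
    then show ?case unfolding atMost_Suc[of m] PiE_insert_eq by auto
  qed
  show ?thesis
    unfolding alg_indep_def
  proof (intro allI impI)
    fix s c
    assume zero: "\<forall>z\<in>S. (\<Sum>a\<in>{..k} \<rightarrow>\<^sub>E {..s}. c a * (\<Prod>j\<le>k. u j z ^ a j)) = 0"
    show "\<forall>a\<in>{..k} \<rightarrow>\<^sub>E {..s}. c a = 0"
    proof (rule main)
      fix t l assume "t \<noteq> (0::complex)" "\<And>i. l i \<in> L i"
      from grid[OF this] obtain z where z: "z \<in> S" "u 0 z = t" "\<And>i. i \<in> {1..k} \<Longrightarrow> u i z = t * l i" by blast
      have "(\<Prod>j\<le>k. (if j = 0 then t else t * l j) ^ a j) = (\<Prod>j\<le>k. u j z ^ a j)" for a :: "nat \<Rightarrow> nat"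
        using z by (intro prod.cong) auto
      then show "(\<Sum>a\<in>{..k} \<rightarrow>\<^sub>E {..s}. c a * (\<Prod>j\<le>k. (if j = 0 then t else t * l j) ^ a j)) = 0"
        using zero z(1) by simp
    qed
  qed
qed

subsection \<open>Chains of irreducible sets\<close>

lemma mon_eval_superset:
  assumes "finite A" "Poly_Mapping.keys m \<subseteq> A"
  shows "mon_eval m v = (\<Prod>i\<in>A. v i ^ Poly_Mapping.lookup m i)"
  unfolding mon_eval_def
  using assms by (intro prod.mono_neutral_left) (auto simp: in_keys_iff)

lemma poly_eval_superset:
  assumes "finite A" "Poly_Mapping.keys f \<subseteq> A"
  shows "poly_eval f v = (\<Sum>m\<in>A. Poly_Mapping.lookup f m * mon_eval m v)"
  unfolding poly_eval_def
  using assms by (intro sum.mono_neutral_left) (auto simp: in_keys_iff)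

lemma poly_eval_add: "poly_eval (f + g) v = poly_eval f v + poly_eval g v"
proof -
  define A where "A = Poly_Mapping.keys f \<union> Poly_Mapping.keys g"
  have "finite A" "Poly_Mapping.keys f \<subseteq> A" "Poly_Mapping.keys g \<subseteq> A" "Poly_Mapping.keys (f + g) \<subseteq> A"
    using keys_add[of f g] by (auto simp: A_def)
  then show ?thesis
    by (simp add: poly_eval_superset[of A] lookup_add algebra_simps sum.distrib)
qed

lemma poly_eval_single: "poly_eval (Poly_Mapping.single m c) v = c * mon_eval m v"
  by (cases "c = 0") (auto simp: poly_eval_def)

lemma mon_eval_add_single:
  "mon_eval (m + Poly_Mapping.single i 1) v = v i * mon_eval m v"
proof -
  define A where "A = insert i (Poly_Mapping.keys m)"
  have A: "finite A" "Poly_Mapping.keys m \<subseteq> A" "Poly_Mapping.keys (m + Poly_Mapping.single i 1) \<subseteq> A" "i \<in> A"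
    using keys_add[of m "Poly_Mapping.single i 1"] by (auto simp: A_def)
  have "(\<Prod>k\<in>A - {i}. v k ^ Poly_Mapping.lookup (m + Poly_Mapping.single i 1) k) =
    (\<Prod>k\<in>A - {i}. v k ^ Poly_Mapping.lookup m k)"
    by (intro prod.cong) (auto simp: lookup_add lookup_single)
  then show ?thesis
    using A by (simp add: mon_eval_superset[of A] prod.remove[of A i] lookup_add)
qed

definition homog_deg :: "nat \<Rightarrow> nat \<Rightarrow> ((nat \<Rightarrow>\<^sub>0 nat) \<Rightarrow>\<^sub>0 complex) \<Rightarrow> bool" where
  "homog_deg N d f \<longleftrightarrow> (\<forall>m\<in>Poly_Mapping.keys f. Poly_Mapping.keys m \<subseteq> {..N} \<and>
     (\<Sum>i\<in>Poly_Mapping.keys m. Poly_Mapping.lookup m i) = d)"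

lemma homog_poly_iff: "homog_poly N f \<longleftrightarrow> (\<exists>d. homog_deg N d f)"
  by (simp add: homog_poly_def homog_deg_def)

lemma hom_fun_poly_eval:
  assumes "homog_deg N d f"
  shows "hom_fun {..N} d (poly_eval f)"
  unfolding poly_eval_def[abs_def]
proof (intro hom_sum hom_scale)
  fix m assume "m \<in> Poly_Mapping.keys f"
  then have m: "Poly_Mapping.keys m \<subseteq> {..N}" "(\<Sum>i\<in>Poly_Mapping.keys m. Poly_Mapping.lookup m i) = d"
    using assms by (auto simp: homog_deg_def)
  have "hom_fun {..N} (\<Sum>i\<in>Poly_Mapping.keys m. Poly_Mapping.lookup m i)
    (\<lambda>v. \<Prod>i\<in>Poly_Mapping.keys m. v i ^ Poly_Mapping.lookup m i)"
    using m(1) by (intro hom_prod hom_var_power) auto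
  then show "hom_fun {..N} d (mon_eval m)" by (simp add: m(2) mon_eval_def[abs_def])
qed

lemma list_mono_mon_eval:
  assumes "set xs \<subseteq> {..N}"
  shows "\<exists>m. Poly_Mapping.keys m \<subseteq> {..N} \<and>
    (\<Sum>i\<in>Poly_Mapping.keys m. Poly_Mapping.lookup m i) = length xs \<and> mon_eval m = list_mono xs"
  using assms
proof (induction xs)
  case Nil
  then show ?case by (intro exI[of _ 0]) (auto simp: mon_eval_def list_mono_def)
next
  case (Cons x xs)
  then obtain m where m: "Poly_Mapping.keys m \<subseteq> {..N}"
    "(\<Sum>i\<in>Poly_Mapping.keys m. Poly_Mapping.lookup m i) = length xs" "mon_eval m = list_mono xs" by auto
  define m' where "m' = m + Poly_Mapping.single x 1"
  have sub: "Poly_Mapping.keys m' \<subseteq> {..N}"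
    using keys_add[of m "Poly_Mapping.single x 1"] m(1) Cons.prems by (auto simp: m'_def)
  have all: "(\<Sum>i\<in>Poly_Mapping.keys q. Poly_Mapping.lookup q i) = (\<Sum>i\<le>N. Poly_Mapping.lookup q i)"
    if "Poly_Mapping.keys q \<subseteq> {..N}" for q :: "nat \<Rightarrow>\<^sub>0 nat"
    using that by (intro sum.mono_neutral_left) (auto simp: in_keys_iff)
  have "(\<Sum>i\<le>N. Poly_Mapping.lookup (Poly_Mapping.single x (1::nat)) i) = 1"
    using Cons.prems by (simp add: lookup_single when_def)
  then have "(\<Sum>i\<in>Poly_Mapping.keys m'. Poly_Mapping.lookup m' i) = Suc (length xs)"
    unfolding all[OF sub] using m(2) unfolding all[OF m(1)] by (simp add: m'_def lookup_add sum.distrib)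
  moreover have "mon_eval m' = list_mono (x # xs)"
    unfolding m'_def using m(3) by (intro ext) (subst mon_eval_add_single, simp add: list_mono_def)
  ultimately show ?case using sub by auto
qed

text \<open>Allows zero sets of homogeneous functions to be recognised as
  \<open>proj_closed\<close>.\<close>

lemma hom_fun_imp_poly:
  assumes "hom_fun {..N} d h"
  shows "\<exists>f. homog_deg N d f \<and> poly_eval f = h"
proof -
  obtain c where c: "h = (\<lambda>z. \<Sum>xs\<in>mono_lists {..N} d. c xs * list_mono xs z)"
    using hom_lin_span[OF _ assms] unfolding lin_span_def by auto
  have "\<exists>f. homog_deg N d f \<and> poly_eval f = (\<lambda>z. \<Sum>xs\<in>A. c xs * list_mono xs z)"
    if "finite A" "A \<subseteq> mono_lists {..N} d" for A
    using that
  proof (induction A rule: finite_induct)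
    case empty
    show ?case by (intro exI[of _ 0]) (auto simp: homog_deg_def poly_eval_def)
  next
    case (insert xs A)
    then obtain f where f: "homog_deg N d f" "poly_eval f = (\<lambda>z. \<Sum>xs\<in>A. c xs * list_mono xs z)" by blast
    obtain m where m: "Poly_Mapping.keys m \<subseteq> {..N}"
      "(\<Sum>i\<in>Poly_Mapping.keys m. Poly_Mapping.lookup m i) = d" "mon_eval m = list_mono xs"
      using list_mono_mon_eval[of xs N] insert.prems by (auto simp: mono_lists_def)
    have "homog_deg N d (Poly_Mapping.single m (c xs) + f)"
      using f(1) m keys_add[of "Poly_Mapping.single m (c xs)" f]
      by (fastforce simp: homog_deg_def split: if_splits)
    moreover have "poly_eval (Poly_Mapping.single m (c xs) + f) = (\<lambda>z. \<Sum>xs\<in>insert xs A. c xs * list_mono xs z)"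
      using insert f(2) m(3) by (auto simp: poly_eval_add poly_eval_single)
    ultimately show ?case by blast
  qed
  then show ?thesis using c finite_mono_lists[of "{..N}" d] by auto
qed

lemma proj_closed_Int_zeros:
  assumes "proj_closed N X" "\<And>h. h \<in> H \<Longrightarrow> \<exists>d. hom_fun {..N} d h"
  shows "proj_closed N {z\<in>X. \<forall>h\<in>H. h z = 0}"
proof -
  obtain F where F: "\<forall>f\<in>F. homog_poly N f" "X = proj_zero_set N F"
    using assms(1) unfolding proj_closed_def by blast
  define F' where "F' = F \<union> {f. homog_poly N f \<and> poly_eval f \<in> H}"
  have "\<exists>f\<in>F'. poly_eval f = h" if h: "h \<in> H" for h
  proof -
    obtain d where "hom_fun {..N} d h" using assms(2) h by blast
    then show ?thesis using hom_fun_imp_poly[of N d h] h unfolding F'_def homog_poly_iff by blast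
  qed
  then have "{z\<in>X. \<forall>h\<in>H. h z = 0} = proj_zero_set N F'"
    unfolding F(2) proj_zero_set_def by (auto simp: F'_def)
  moreover have "\<forall>f\<in>F'. homog_poly N f" using F(1) by (auto simp: F'_def)
  ultimately show ?thesis unfolding proj_closed_def by blast
qed

lemma pvec_scale: "pvec N v \<Longrightarrow> t \<noteq> 0 \<Longrightarrow> pvec N (\<lambda>i. t * v i)"
  by (auto simp: pvec_def)

lemma proj_closed_cone:
  assumes "proj_closed N X"
  shows "cone X"
proof -
  obtain F where F: "\<forall>f\<in>F. homog_poly N f" "X = proj_zero_set N F"
    using assms unfolding proj_closed_def by blast
  have "poly_eval f (\<lambda>i. t * z i) = 0" if f: "f \<in> F" "poly_eval f z = 0" for f t z
  proof -
    obtain d where "homog_deg N d f" using F(1) f(1) unfolding homog_poly_iff by blast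
    then show ?thesis using hom_eval_scale[OF hom_fun_poly_eval] f(2) by simp
  qed
  then show ?thesis unfolding cone_def F(2) proj_zero_set_def by (auto intro: pvec_scale)
qed

lemma proj_closed_hom_closure:
  assumes "proj_closed N X"
  shows "hom_closure {..N} X \<subseteq> X"
proof
  fix r assume r: "r \<in> hom_closure {..N} X"
  obtain F where F: "\<forall>f\<in>F. homog_poly N f" "X = proj_zero_set N F"
    using assms unfolding proj_closed_def by blast
  have "poly_eval f r = 0" if f: "f \<in> F" for f
  proof -
    obtain d where "homog_deg N d f" using F(1) f unfolding homog_poly_iff by blast
    moreover have "\<forall>z\<in>X. poly_eval f z = 0" using f F(2) by (auto simp: proj_zero_set_def)
    ultimately show ?thesis using r hom_fun_poly_eval unfolding hom_closure_def by blast
  qed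
  moreover have "pvec N r" using r by (auto simp: hom_closure_def pvec_def)
  ultimately show "r \<in> X" by (simp add: F(2) proj_zero_set_def)
qed

lemma proj_closed_pvec: "proj_closed N X \<Longrightarrow> z \<in> X \<Longrightarrow> pvec N z"
  by (auto simp: proj_closed_def proj_zero_set_def)

text \<open>The coordinate ring of an irreducible set is a domain. As \<open>Z\<close> is a cone,
  the hypothesis holds at all multiples \<open>t * w\<close>, so where \<open>f w \<noteq> 0\<close>
  each homogeneous component of \<open>P\<close> vanishes. Thus \<open>Z\<close> is the union of the
  zeros of \<open>f\<close> and the common zeros of the components.\<close>

lemma proj_irreducible_cancel:
  assumes Z: "proj_irreducible N Z" and f: "hom_fun {..N} e f" and z0: "z0 \<in> Z" "f z0 \<noteq> 0"
    and P: "poly_fun {..N} P" and zero: "\<And>z. z \<in> Z \<Longrightarrow> f z * P z = 0"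
    and z: "z \<in> Z"
  shows "P z = 0"
proof -
  have closed: "proj_closed N Z" using Z by (simp add: proj_irreducible_def)
  obtain D h where h: "\<forall>d. hom_fun {..N} d (h d)" "P = (\<lambda>z. \<Sum>d\<le>D. h d z)"
    using P pd_decompose unfolding poly_fun_def by blast
  define A where "A = {z\<in>Z. \<forall>g\<in>{f}. g z = 0}"
  define B where "B = {z\<in>Z. \<forall>g\<in>h ` {..D}. g z = 0}"
  have "proj_closed N A" "proj_closed N B"
    unfolding A_def B_def by (rule proj_closed_Int_zeros[OF closed], use f h(1) in blast)+
  moreover have "Z = A \<union> B"
  proof -
    have "h d w = 0" if w: "w \<in> Z" "f w \<noteq> 0" "d \<le> D" for w d
    proof (rule polyfun_zero_on_infinite[OF infinite_nonzero_complex _ w(3)])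
      fix t :: complex assume t: "t \<in> {t. t \<noteq> 0}"
      have "(\<lambda>i. t * w i) \<in> Z" using proj_closed_cone[OF closed] w(1) t by (intro coneD) auto
      then have "f (\<lambda>i. t * w i) * P (\<lambda>i. t * w i) = 0" by (rule zero)
      moreover have "f (\<lambda>i. t * w i) \<noteq> 0" using hom_eval_scale[OF f] w(2) t by simp
      ultimately have "P (\<lambda>i. t * w i) = 0" by simp
      moreover have "P (\<lambda>i. t * w i) = (\<Sum>d\<le>D. h d w * t ^ d)"
        unfolding h(2) using hom_eval_scale[OF h(1)[rule_format]] by (simp add: mult.commute)
      ultimately show "(\<Sum>d\<le>D. h d w * t ^ d) = 0" by simp
    qed
    then show ?thesis by (auto simp: A_def B_def)
  qed
  moreover have "Z \<noteq> A" using z0 by (auto simp: A_def)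
  ultimately have "Z = B" using Z unfolding proj_irreducible_def by blast
  then have "z \<in> B" using z by simp
  then show ?thesis unfolding h(2) B_def by (intro sum.neutral) auto
qed

text \<open>In a relation between the old functions and \<open>f\<close>, coefficients are removed
  from the lowest power of \<open>f\<close> upwards: irreducibility of \<open>Z'\<close> allows
  division by \<open>f\<close>, and restriction to \<open>Z\<close>, where \<open>f\<close>
  vanishes, isolates the lowest coefficient as a relation between the old functions.\<close>

lemma alg_indep_extend:
  assumes indep: "alg_indep Z k u" and sub: "Z \<subseteq> Z'" and irr: "proj_irreducible N Z'"
    and u: "\<And>j. j \<le> k \<Longrightarrow> poly_fun {..N} (u j)"
    and f: "hom_fun {..N} e f" "\<And>z. z \<in> Z \<Longrightarrow> f z = 0" and z0: "z0 \<in> Z'" "f z0 \<noteq> 0"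
  shows "alg_indep Z' (Suc k) (u(Suc k := f))"
  unfolding alg_indep_def
proof (intro allI impI)
  fix s c
  define Q where "Q y z = (\<Sum>a\<in>{..k} \<rightarrow>\<^sub>E {..s}. c (a(Suc k := y)) * (\<Prod>j\<le>k. u j z ^ a j))" for y z
  assume "\<forall>z\<in>Z'. (\<Sum>a\<in>{..Suc k} \<rightarrow>\<^sub>E {..s}. c a * (\<Prod>j\<le>Suc k. (u(Suc k := f)) j z ^ a j)) = 0"
  moreover have "(\<Prod>j\<le>k. (u(Suc k := f)) j z ^ a j) = (\<Prod>j\<le>k. u j z ^ a j)" for a z
    by (intro prod.cong) auto
  ultimately have zero: "(\<Sum>y\<le>s. Q y z * f z ^ y) = 0" if "z \<in> Z'" for z
    using that unfolding sum_PiE_Suc Q_def by simp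
  have pf_pow: "poly_fun {..N} (\<lambda>z. g z ^ y)" if "poly_fun {..N} g" for g y
    using that pd_power unfolding poly_fun_def by blast
  have Q_pf: "poly_fun {..N} (Q y)" for y
    unfolding Q_def[abs_def] using u by (intro pf_sum pf_mult pf_const pf_prod pf_pow) auto
  have "\<forall>a\<in>{..k} \<rightarrow>\<^sub>E {..s}. c (a(Suc k := y)) = 0" if "y \<le> s" for y
    using that
  proof (induction y rule: less_induct)
    case (less y)
    have small: "Q x z = 0" if x: "x < y" for x z
    proof -
      have "x \<le> s" using x less.prems by simp
      then have "c (a(Suc k := x)) = 0" if "a \<in> {..k} \<rightarrow>\<^sub>E {..s}" for a
        by (rule bspec[OF less.IH[OF x] that])
      then show ?thesis unfolding Q_def by (intro sum.neutral ballI) (simp only: mult_zero_left)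
    qed
    \<comment> \<open>What is left of the relation after the coefficients below \<open>y\<close>
      have vanished, divided by \<open>f ^ y\<close>.\<close>
    define R where "R z = (\<Sum>x\<in>{y..s}. Q x z * f z ^ (x - y))" for z
    have "f z ^ y * R z = 0" if z: "z \<in> Z'" for z
    proof -
      have "(\<Sum>x\<le>s. Q x z * f z ^ x) = (\<Sum>x\<in>{y..s}. Q x z * f z ^ x)"
        using small by (intro sum.mono_neutral_right) (auto simp: not_le)
      also have "\<dots> = f z ^ y * R z"
        unfolding R_def sum_distrib_left
        by (intro sum.cong refl) (simp add: power_add[symmetric] mult.left_commute)
      finally show ?thesis using zero[OF z] by simp
    qed
    moreover have "poly_fun {..N} R"
      unfolding R_def[abs_def] by (intro pf_sum pf_mult Q_pf pf_pow hom_imp_pf[OF f(1)])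
    moreover have "f z0 ^ y \<noteq> 0" using z0(2) by simp
    ultimately have R0: "R z = 0" if "z \<in> Z'" for z
      using proj_irreducible_cancel[OF irr hom_power[OF f(1), of y] z0(1)] that by blast
    have "Q y z = 0" if z: "z \<in> Z" for z
    proof -
      \<comment> \<open>On \<open>Z\<close> the powers \<open>f z ^ (x - y)\<close> are 0 except for
        \<open>x = y\<close>, where the exponent is 0.\<close>
      have "R z = (\<Sum>x\<in>{y..s}. if x = y then Q y z else 0)"
        unfolding R_def using f(2)[OF z] by (intro sum.cong) auto
      then show ?thesis using R0[of z] z sub less.prems by auto
    qed
    then have "\<forall>z\<in>Z. (\<Sum>a\<in>{..k} \<rightarrow>\<^sub>E {..s}. c (a(Suc k := y)) * (\<Prod>j\<le>k. u j z ^ a j)) = 0"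
      unfolding Q_def by blast
    then show ?case by (rule indep[unfolded alg_indep_def, THEN spec, THEN spec, THEN mp])
  qed
  then show "\<forall>a\<in>{..Suc k} \<rightarrow>\<^sub>E {..s}. c a = 0"
    unfolding atMost_Suc[of k] PiE_insert_eq by auto
qed

text \<open>Each strict inclusion supplies a form vanishing on the smaller set but not on the larger
  one, which extends the independent family by one. The smallest set already contributes a nonzero
  coordinate.\<close>

lemma irred_chain_alg_indep:
  assumes "irred_chain N X Z n"
  shows "\<exists>u. (\<forall>j\<le>n. poly_fun {..N} (u j)) \<and> alg_indep (Z n) n u"
  using assms
proof (induction n)
  case 0
  then have irr: "proj_irreducible N (Z 0)" by (simp add: irred_chain_def)
  then have closed: "proj_closed N (Z 0)" by (simp add: proj_irreducible_def)
  obtain v where v: "v \<in> Z 0" using irr by (auto simp: proj_irreducible_def)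
  then obtain i where i: "i \<le> N" "v i \<noteq> 0" using proj_closed_pvec[OF closed] by (auto simp: pvec_def)
  \<comment> \<open>Scaling a single point of the cone gives the coordinate every nonzero value;
    with \<open>k = 0\<close> there are no ratios to prescribe.\<close>
  have "alg_indep (Z 0) 0 (\<lambda>_ z. z i)"
  proof (rule alg_indep_grid[of "\<lambda>_. UNIV"])
    fix t :: complex and l :: "nat \<Rightarrow> complex" assume "t \<noteq> 0"
    then have "(\<lambda>k. (t / v i) * v k) \<in> Z 0"
      using i by (intro coneD[OF proj_closed_cone[OF closed] v]) auto
    then show "\<exists>z\<in>Z 0. z i = t \<and> (\<forall>k\<in>{1..0}. z i = t * l k)"
      using i by (intro bexI[of _ "\<lambda>k. (t / v i) * v k"]) auto
  qed (simp add: infinite_UNIV_char_0)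
  then show ?case using i(1) by (intro exI[of _ "\<lambda>_ z. z i"]) (auto intro: pf_var)
next
  case (Suc n)
  have "irred_chain N X Z n" using Suc.prems by (auto simp: irred_chain_def)
  then obtain u where u: "\<forall>j\<le>n. poly_fun {..N} (u j)" "alg_indep (Z n) n u" using Suc.IH by blast
  have irr: "proj_irreducible N (Z n)" "proj_irreducible N (Z (Suc n))" and sub: "Z n \<subset> Z (Suc n)"
    using Suc.prems by (auto simp: irred_chain_def)
  obtain z0 where z0: "z0 \<in> Z (Suc n)" "z0 \<notin> Z n" using sub by blast
  obtain F where F: "\<forall>f\<in>F. homog_poly N f" "Z n = proj_zero_set N F"
    using irr(1) unfolding proj_irreducible_def proj_closed_def by blast
  have "pvec N z0" using z0(1) irr(2) proj_closed_pvec by (auto simp: proj_irreducible_def)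
  then obtain f where f: "f \<in> F" "poly_eval f z0 \<noteq> 0" using z0(2) F(2) by (auto simp: proj_zero_set_def)
  obtain d where d: "hom_fun {..N} d (poly_eval f)"
    using F(1) f(1) hom_fun_poly_eval unfolding homog_poly_iff by blast
  have "alg_indep (Z (Suc n)) (Suc n) (u(Suc n := poly_eval f))"
    using f(1) F(2) u(1) sub z0(1) f(2)
    by (intro alg_indep_extend[OF u(2) _ irr(2) _ d]) (auto simp: proj_zero_set_def)
  moreover have "\<forall>j\<le>Suc n. poly_fun {..N} ((u(Suc n := poly_eval f)) j)"
    using u(1) hom_imp_pf[OF d] by (auto simp: le_Suc_eq)
  ultimately show ?case by blast
qed

text \<open>The dimension inequality for hyperplane sections: a chain with \<open>n\<close> steps
  gives \<open>n + 1\<close> independent functions, one more than there are forms.\<close>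

lemma irred_chain_common_zero:
  assumes "proj_closed N X" "irred_chain N X Z n" "finite K" "card K = n"
    and F: "\<And>k. k \<in> K \<Longrightarrow> hom_fun {..N} 1 (F k)"
  shows "\<exists>r\<in>X. \<forall>k\<in>K. F k r = 0"
proof -
  obtain u where u: "\<forall>j\<le>n. poly_fun {..N} (u j)" "alg_indep (Z n) n u"
    using irred_chain_alg_indep[OF assms(2)] by blast
  have "Z n \<subseteq> X" using assms(2) by (simp add: irred_chain_def)
  then have "alg_indep X (card K) u" using alg_indep_mono u(2) assms(4) by blast
  then have "\<exists>r\<in>hom_closure {..N} X. \<forall>k\<in>K. F k r = 0"
    using u(1) assms(4) F
    by (intro common_zero_of_linear_forms[OF _ proj_closed_cone[OF assms(1)] assms(3)]) auto
  then show ?thesis using proj_closed_hom_closure[OF assms(1)] by blast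
qed

subsection \<open>Curve sections and Segre products\<close>

text \<open>Closedness expressed without a choice of defining equations, ready for the common zero
  theorem.\<close>

definition closed_cone :: "nat \<Rightarrow> (nat \<Rightarrow> complex) set \<Rightarrow> bool" where
  "closed_cone N S \<longleftrightarrow> (\<forall>z\<in>S. pvec N z) \<and> cone S \<and> hom_closure {..N} S \<subseteq> S"

lemma proj_closed_closed_cone: "proj_closed N X \<Longrightarrow> closed_cone N X"
  by (simp add: closed_cone_def proj_closed_pvec proj_closed_cone proj_closed_hom_closure)

lemma closed_cone_Int_zeros:
  assumes "closed_cone N S" and H: "\<And>h. h \<in> H \<Longrightarrow> \<exists>d. hom_fun {..N} d h"
  shows "closed_cone N {z\<in>S. \<forall>h\<in>H. h z = 0}"
proof -
  let ?T = "{z\<in>S. \<forall>h\<in>H. h z = 0}"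
  have S: "\<forall>z\<in>S. pvec N z" "cone S" "hom_closure {..N} S \<subseteq> S"
    using assms(1) by (auto simp: closed_cone_def)
  have "cone ?T"
    unfolding cone_def
  proof (intro ballI allI impI CollectI conjI)
    fix z and t :: complex assume z: "z \<in> ?T" "t \<noteq> 0"
    then show "(\<lambda>i. t * z i) \<in> S" using coneD[OF S(2)] by auto
    fix h assume h: "h \<in> H"
    then obtain d where "hom_fun {..N} d h" using H by blast
    then show "h (\<lambda>i. t * z i) = 0" using hom_eval_scale[of "{..N}" d h] z h by auto
  qed
  moreover have "hom_closure {..N} ?T \<subseteq> ?T"
  proof
    fix r assume r: "r \<in> hom_closure {..N} ?T"
    then have "r \<in> hom_closure {..N} S" by (auto simp: hom_closure_def)
    moreover have "h r = 0" if h: "h \<in> H" for h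
    proof -
      obtain d where "hom_fun {..N} d h" using H h by blast
      moreover have "\<forall>z\<in>?T. h z = 0" using h by blast
      ultimately show ?thesis using r unfolding hom_closure_def by blast
    qed
    ultimately show "r \<in> ?T" using S(3) by blast
  qed
  ultimately show ?thesis using S(1) by (auto simp: closed_cone_def)
qed

section \<open>Points with few zero coordinates and general hyperplane sections\<close>

definition zero_coords :: "nat \<Rightarrow> (nat \<Rightarrow> complex) \<Rightarrow> nat set" where
  "zero_coords N z = {i. i \<le> N \<and> z i = 0}"

lemma finite_zero_coords: "finite (zero_coords N z)"
  by (simp add: zero_coords_def)

text \<open>If the ratio took infinitely many values, \<open>z j\<close> and \<open>z i\<close>
  would be independent on \<open>T\<close>, and the single form \<open>z j\<close> would have a zero
  there.\<close>

lemma finite_coordinate_ratios: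
  assumes T: "closed_cone N T" and i: "i \<le> N" and j: "j \<le> N" "\<And>z. z \<in> T \<Longrightarrow> z j \<noteq> 0"
  shows "finite ((\<lambda>z. z i / z j) ` T)"
proof (rule ccontr)
  assume inf: "infinite ((\<lambda>z. z i / z j) ` T)"
  have T': "cone T" "hom_closure {..N} T \<subseteq> T" using T by (auto simp: closed_cone_def)
  define u where "u k = (\<lambda>z :: nat \<Rightarrow> complex. if k = 0 then z j else z i)" for k :: nat
  have "alg_indep T (card {j}) u"
  proof (rule alg_indep_grid[of "\<lambda>_. (\<lambda>z. z i / z j) ` T"])
    fix t :: complex and l :: "nat \<Rightarrow> complex" assume t: "t \<noteq> 0" and l: "\<And>k. l k \<in> (\<lambda>z. z i / z j) ` T"
    obtain z where z: "z \<in> T" "l 1 = z i / z j" using l[of 1] by blast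
    have "(\<lambda>k. (t / z j) * z k) \<in> T" using t j(2)[OF z(1)] z(1) by (intro coneD[OF T'(1)]) auto
    then show "\<exists>z\<in>T. u 0 z = t \<and> (\<forall>k\<in>{1..card {j}}. u k z = t * l k)"
      using j(2)[OF z(1)] z(2) by (intro bexI[of _ "\<lambda>k. (t / z j) * z k"]) (auto simp: u_def)
  qed (use inf in simp)
  moreover have "poly_fun {..N} (u k)" for k
    using i j(1) unfolding u_def by (cases "k = 0") (auto intro: pf_var)
  ultimately have "\<exists>r\<in>hom_closure {..N} T. \<forall>k\<in>{j}. r j = 0"
    using j(1)
    by (intro common_zero_of_linear_forms[OF _ T'(1), where F = "\<lambda>_ z. z j"])
      (auto intro: hom_var[unfolded One_nat_def])
  then show False using T'(2) j(2) by auto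
qed

text \<open>A projective set missing a hyperplane is finite: a point with \<open>z j = 1\<close> is
  determined by its coordinate ratios, each of which has finitely many values.\<close>

lemma finite_normalized_points:
  assumes T: "closed_cone N T" and j: "j \<le> N" "\<And>z. z \<in> T \<Longrightarrow> z j \<noteq> 0"
  shows "finite {z\<in>T. z j = 1}"
proof (rule finite_imageD)
  show "inj_on (\<lambda>z. restrict z {..N}) {z\<in>T. z j = 1}"
  proof (rule inj_onI, rule ext)
    fix z w i assume zw: "z \<in> {z\<in>T. z j = 1}" "w \<in> {z\<in>T. z j = 1}" "restrict z {..N} = restrict w {..N}"
    have "pvec N z" "pvec N w" using T zw by (auto simp: closed_cone_def)
    then show "z i = w i"
      using fun_cong[OF zw(3), of i] by (cases "i \<le> N") (auto simp: pvec_def)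
  qed
  have "(\<lambda>z. restrict z {..N}) ` {z\<in>T. z j = 1} \<subseteq> (\<Pi>\<^sub>E i\<in>{..N}. (\<lambda>z. z i / z j) ` T)"
    by (force simp: image_iff)
  moreover have "finite (\<Pi>\<^sub>E i\<in>{..N}. (\<lambda>z. z i / z j) ` T)"
    by (intro finite_PiE finite_coordinate_ratios[OF T]) (auto simp: j)
  ultimately show "finite ((\<lambda>z. restrict z {..N}) ` {z\<in>T. z j = 1})"
    by (rule finite_subset)
qed

text \<open>Fix a pattern \<open>I\<close> of \<open>Suc m\<close> zeros. No further coordinate can
  vanish on \<open>T I\<close>, so \<open>T I\<close> is finite up to scaling. There are finitely
  many patterns, and a general hyperplane avoids all these points.\<close>

lemma separating_linear_form:
  assumes S: "closed_cone N S" and zeros: "\<And>z. z \<in> S \<Longrightarrow> card (zero_coords N z) \<le> Suc m" and m: "Suc m \<le> N"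
  shows "\<exists>G. hom_fun {..N} 1 G \<and> (\<forall>z\<in>S. G z = 0 \<longrightarrow> card (zero_coords N z) \<le> m)"
proof -
  define P where "P = {(I, j). I \<subseteq> {..N} \<and> card I = Suc m \<and> j \<le> N \<and> j \<notin> I}"
  define T where "T I = {z\<in>S. \<forall>h\<in>(\<lambda>i z. z i) ` I. h z = 0}" for I
  define E where "E = (\<Union>(I, j)\<in>P. {z\<in>T I. z j = 1})"
  have "finite {z\<in>T I. z j = 1}" if "(I, j) \<in> P" for I j
  proof (rule finite_normalized_points)
    have I: "I \<subseteq> {..N}" "card I = Suc m" "j \<le> N" "j \<notin> I" using that by (auto simp: P_def)
    show "closed_cone N (T I)"
      unfolding T_def using I(1) hom_var[of _ "{..N}"] by (intro closed_cone_Int_zeros[OF S]) blast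
    show "j \<le> N" by fact
    fix z assume z: "z \<in> T I"
    show "z j \<noteq> 0"
    proof
      assume "z j = 0"
      then have "insert j I \<subseteq> zero_coords N z" using z I by (auto simp: T_def zero_coords_def)
      then have "card (insert j I) \<le> Suc m"
        using card_mono[OF finite_zero_coords, of "insert j I" N z] zeros[of z] z by (simp add: T_def)
      moreover have "card (insert j I) = Suc (Suc m)" using I finite_subset[OF I(1)] by simp
      ultimately show False by simp
    qed
  qed
  moreover have "finite P"
    by (rule finite_subset[of _ "Pow {..N} \<times> {..N}"]) (auto simp: P_def)
  ultimately have "finite E" unfolding E_def by auto
  \<comment> \<open>Candidate forms have the coefficients \<open>s ^ i\<close>. Each point is a
    nonzero vector, so the form vanishes there for only finitely many \<open>s\<close>.\<close>
  have "finite {s. (\<Sum>i\<le>N. z i * s ^ i) = 0}" if "z \<in> E" for z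
    using that unfolding polyfun_finite_roots by (force simp: E_def P_def)
  then have "finite (\<Union>z\<in>E. {s. (\<Sum>i\<le>N. z i * s ^ i) = 0})" using \<open>finite E\<close> by blast
  then obtain s where s: "s \<notin> (\<Union>z\<in>E. {s. (\<Sum>i\<le>N. z i * s ^ i) = 0})"
    using ex_new_if_finite[OF infinite_UNIV_char_0] by blast
  define G where "G z = (\<Sum>i\<le>N. s ^ i * z i)" for z :: "nat \<Rightarrow> complex"
  have G: "hom_fun {..N} 1 G" unfolding G_def[abs_def] by (intro hom_sum hom_scale hom_var)
  have "card (zero_coords N z) \<le> m" if z: "z \<in> S" "G z = 0" for z
  proof (rule ccontr)
    assume "\<not> ?thesis"
    then have card: "card (zero_coords N z) = Suc m" using zeros[OF z(1)] by simp
    have "\<not> {..N} \<subseteq> zero_coords N z"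
      using card_mono[OF finite_zero_coords, of "{..N}" N z] card m by auto
    then obtain j where j: "j \<le> N" "j \<notin> zero_coords N z" by auto
    then have zj: "z j \<noteq> 0" by (simp add: zero_coords_def)
    \<comment> \<open>Rescaled so that \<open>w j = 1\<close>, the point becomes one of the finitely
      many representatives in \<open>E\<close>.\<close>
    define w where "w = (\<lambda>i. (1 / z j) * z i)"
    have "w \<in> S" unfolding w_def using S z(1) zj by (intro coneD) (auto simp: closed_cone_def)
    then have "w \<in> T (zero_coords N z)" "w j = 1" using zj by (auto simp: T_def w_def zero_coords_def)
    moreover have "(zero_coords N z, j) \<in> P" using j card by (auto simp: P_def zero_coords_def)
    ultimately have "w \<in> E" unfolding E_def by blast
    moreover have "G w = 0" using hom_eval_scale[OF G, of "1 / z j" z] z(2) by (simp add: w_def)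
    ultimately show False using s by (auto simp: G_def mult.commute)
  qed
  then show ?thesis using G by blast
qed

text \<open>Each cut by a separating form lowers the bound by one, so \<open>m\<close> cuts bring it
  from \<open>Suc m\<close> down to 1.\<close>

lemma curve_section:
  assumes "closed_cone N S" "\<And>z. z \<in> S \<Longrightarrow> card (zero_coords N z) \<le> Suc m" "Suc m \<le> N"
  shows "\<exists>G. (\<forall>l<m. hom_fun {..N} 1 (G l)) \<and>
    (\<forall>z\<in>S. (\<forall>l<m. G l z = 0) \<longrightarrow> card (zero_coords N z) \<le> 1)"
  using assms
proof (induction m arbitrary: S)
  case 0
  then show ?case by auto
next
  case (Suc m)
  obtain H where H: "hom_fun {..N} 1 H" "\<And>z. z \<in> S \<Longrightarrow> H z = 0 \<Longrightarrow> card (zero_coords N z) \<le> Suc m"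
    using separating_linear_form[OF Suc.prems] by blast
  define S' where "S' = {z\<in>S. \<forall>h\<in>{H}. h z = 0}"
  have "closed_cone N S'"
    unfolding S'_def using H(1) by (intro closed_cone_Int_zeros[OF Suc.prems(1)]) blast
  moreover have "card (zero_coords N z) \<le> Suc m" if "z \<in> S'" for z using that H(2) by (simp add: S'_def)
  ultimately obtain G where G: "\<forall>l<m. hom_fun {..N} 1 (G l)"
    "\<forall>z\<in>S'. (\<forall>l<m. G l z = 0) \<longrightarrow> card (zero_coords N z) \<le> 1"
    using Suc.IH[of S'] Suc.prems(3) by auto
  show ?case
  proof (intro exI[of _ "G(m := H)"] conjI allI impI ballI)
    fix l assume "l < Suc m"
    then show "hom_fun {..N} 1 ((G(m := H)) l)" using H(1) G(1) by (auto simp: less_Suc_eq)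
  next
    fix z assume z: "z \<in> S" "\<forall>l<Suc m. (G(m := H)) l z = 0"
    have "H z = 0" using z(2)[rule_format, of m] by simp
    moreover have "G l z = 0" if "l < m" for l using z(2)[rule_format, of l] that by simp
    ultimately show "card (zero_coords N z) \<le> 1" using G(2) z(1) by (simp add: S'_def)
  qed
qed

section \<open>Segre coordinates and products of curve points\<close>

lemma common_nonzero_coordinate:
  assumes "\<And>a. a < N \<Longrightarrow> card (zero_coords N (x a)) \<le> 1"
  shows "\<exists>i\<le>N. \<forall>a<N. x a i \<noteq> 0"
proof (rule ccontr)
  assume "\<not> ?thesis"
  \<comment> \<open>\<open>N\<close> points with at most one zero each cannot cover all
    \<open>N + 1\<close> coordinates.\<close>
  then have "{..N} \<subseteq> (\<Union>a<N. zero_coords N (x a))" by (fastforce simp: zero_coords_def)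
  then have "card {..N} \<le> card (\<Union>a<N. zero_coords N (x a))"
    by (intro card_mono) (auto simp: finite_zero_coords)
  also have "\<dots> \<le> (\<Sum>a<N. card (zero_coords N (x a)))" by (intro card_UN_le) simp
  also have "\<dots> \<le> (\<Sum>a<N. 1)" using assms by (intro sum_mono) auto
  finally show False by simp
qed

text \<open>Segre coordinates on the product of \<open>N\<close> copies of the space:
  \<open>j\<close> selects one coordinate in each factor. The entries at constant \<open>j\<close>
  form the Hadamard product.\<close>

definition segre :: "nat \<Rightarrow> (nat \<Rightarrow> nat \<Rightarrow> complex) \<Rightarrow> (nat \<Rightarrow> nat) \<Rightarrow> complex" where
  "segre N x j = (\<Prod>a<N. x a (j a))"

lemma segre_update:
  "a < N \<Longrightarrow> segre N x (j(a := i)) = (\<Prod>b\<in>{..<N} - {a}. x b (j b)) * x a i"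
  unfolding segre_def by (simp add: prod.remove[of "{..<N}" a] mult.commute)

lemma cone_segre:
  assumes "cone C" "N \<ge> 1"
  shows "cone (segre N ` {x. \<forall>a<N. x a \<in> C})"
  unfolding cone_def
proof (intro ballI allI impI)
  fix z and t :: complex assume z: "z \<in> segre N ` {x. \<forall>a<N. x a \<in> C}" and t: "t \<noteq> 0"
  then obtain x where x: "\<forall>a<N. x a \<in> C" "z = segre N x" by blast
  \<comment> \<open>The scalar is absorbed by the factor 0, which exists because
    \<open>N \<ge> 1\<close>.\<close>
  have "segre N (x(0 := \<lambda>i. t * x 0 i)) j = t * segre N x j" for j
    using assms(2) unfolding segre_def by (simp add: prod.remove[of "{..<N}" 0] mult.assoc)
  then have "(\<lambda>j. t * z j) = segre N (x(0 := \<lambda>i. t * x 0 i))" using x(2) by auto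
  moreover have "\<forall>a<N. (x(0 := \<lambda>i. t * x 0 i)) a \<in> C" using x(1) coneD[OF assms(1)] t by simp
  ultimately show "(\<lambda>j. t * z j) \<in> segre N ` {x. \<forall>a<N. x a \<in> C}" by blast
qed

text \<open>The Segre image of \<open>C\<^sup>N\<close> is closed: a point \<open>r\<close> of its closure with \<open>r j \<noteq> 0\<close> is the Segre image,
  up to a factor, of the slices of \<open>r\<close> through \<open>j\<close>.\<close>

lemma hom_closure_segre:
  assumes C: "closed_cone N C" and N: "N \<ge> 1"
    and r: "r \<in> hom_closure ({..<N} \<rightarrow>\<^sub>E {..N}) (segre N ` {x. \<forall>a<N. x a \<in> C})"
  shows "\<exists>x q. (\<forall>a<N. x a \<in> C) \<and> q \<noteq> 0 \<and>
    (\<forall>i\<le>N. (\<Prod>a<N. x a i) = q * r (restrict (\<lambda>_. i) {..<N}))"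
proof -
  let ?I = "{..<N} \<rightarrow>\<^sub>E {..N}" and ?S = "segre N ` {x. \<forall>a<N. x a \<in> C}"
  obtain j where j: "j \<in> ?I" "r j \<noteq> 0" using r by (auto simp: hom_closure_def)
  have vanish: "h r = 0" if "hom_fun ?I d h" "\<And>x. \<forall>a<N. x a \<in> C \<Longrightarrow> h (segre N x) = 0" for d h
    using r that unfolding hom_closure_def by blast
  have upd: "j(a := i) \<in> ?I" if "a < N" "i \<le> N" for a i
    using j(1) that by (auto simp: PiE_iff extensional_def)
  define x where "x a i = (if i \<le> N then r (j(a := i)) else 0)" for a i
  have "x a \<in> C" if a: "a < N" for a
  proof -
    have "h (x a) = 0" if h: "hom_fun {..N} d h" "\<forall>z\<in>C. h z = 0" for d h
    proof -
      \<comment> \<open>On a Segre point the slice through \<open>j\<close> in direction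
        \<open>a\<close> is a multiple of \<open>x' a\<close>, so a form vanishing on
        \<open>C\<close> vanishes on it; this passes to the closure.\<close>
      have "(\<lambda>z. h (\<lambda>i. z (j(a := i)))) r = 0"
      proof (rule vanish)
        show "hom_fun ?I d (\<lambda>z. h (\<lambda>i. z (j(a := i))))"
          by (rule hom_rename[OF h(1), where s = "\<lambda>i. j(a := i)"]) (simp add: upd[OF a])
        show "h (\<lambda>i. segre N x' (j(a := i))) = 0" if "\<forall>a<N. x' a \<in> C" for x'
          using that a h unfolding segre_update[OF a] hom_eval_scale[OF h(1)] by simp
      qed
      moreover have "h (x a) = h (\<lambda>i. r (j(a := i)))"
        by (rule hom_eval_cong[OF h(1)]) (simp add: x_def)
      ultimately show ?thesis by simp
    qed
    moreover have "x a (j a) \<noteq> 0" "j a \<le> N" using j a by (auto simp: x_def PiE_iff)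
    moreover have "x a i = 0" if "i \<notin> {..N}" for i using that by (simp add: x_def)
    ultimately have "x a \<in> hom_closure {..N} C" unfolding hom_closure_def by blast
    then show ?thesis using C by (auto simp: closed_cone_def)
  qed
  moreover have "(\<Prod>a<N. x a i) = r j ^ N / r j * r (restrict (\<lambda>_. i) {..<N})" if i: "i \<le> N" for i
  proof -
    let ?c = "restrict (\<lambda>_. i) {..<N}"
    have c: "?c \<in> ?I" using i by auto
    \<comment> \<open>A binomial form of degree \<open>N + 1\<close> vanishing on the Segre image.
      At \<open>r\<close> it gives the product of the slices up to the factor
      \<open>r j ^ N / r j\<close>.\<close>
    have "(\<lambda>z. (\<Prod>a<N. z (j(a := i))) * z j - z j ^ N * z ?c) r = 0"
    proof (rule vanish)
      have "hom_fun ?I (\<Sum>a<N. 1) (\<lambda>z. \<Prod>a<N. z (j(a := i)))"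
        using upd i by (intro hom_prod hom_var) auto
      then have "hom_fun ?I N (\<lambda>z. \<Prod>a<N. z (j(a := i)))" by simp
      then show "hom_fun ?I (N + 1) (\<lambda>z. (\<Prod>a<N. z (j(a := i))) * z j - z j ^ N * z ?c)"
        using j(1) c by (intro hom_diff hom_mult hom_var_power hom_var)
      fix x' assume "\<forall>a<N. x' a \<in> C"
      have "segre N x' (j(a := i)) * x' a (j a) = segre N x' j * x' a i" if "a < N" for a
        using segre_update[OF that, of x' j i] segre_update[OF that, of x' j "j a"] by simp
      then have "(\<Prod>a<N. segre N x' (j(a := i)) * x' a (j a)) = (\<Prod>a<N. segre N x' j * x' a i)"
        by (intro prod.cong) auto
      then show "(\<Prod>a<N. segre N x' (j(a := i))) * segre N x' j - segre N x' j ^ N * segre N x' ?c = 0"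
        by (simp add: prod.distrib segre_def[of N x' j, symmetric] segre_def[of N x' ?c])
    qed
    then show ?thesis using j(2) i by (simp add: x_def field_simps)
  qed
  moreover have "r j ^ N / r j \<noteq> 0" using j(2) by simp
  ultimately show ?thesis by blast
qed

text \<open>The condition \<open>onto\<close> makes \<open>N + 1\<close> Segre coordinates
  independent on the image of the \<open>N\<close>-fold product of \<open>C\<close>, so the
  \<open>N\<close> linear equations stating proportionality to \<open>p\<close> are solvable there.
  The condition \<open>zeros\<close> keeps the resulting product from vanishing identically.\<close>

lemma hadamard_product_of_curve_points:
  assumes C: "closed_cone N C" and zeros: "\<And>z. z \<in> C \<Longrightarrow> card (zero_coords N z) \<le> 1" and N: "N \<ge> 1"
    and onto: "\<And>s. \<exists>z\<in>C. z 0 = 1 \<and> z 1 = s" and p: "pvec N p"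
  shows "\<exists>x q. (\<forall>a<N. x a \<in> C) \<and> q \<noteq> 0 \<and> p = (\<lambda>i. q * (\<Prod>a<N. x a i))"
proof -
  let ?I = "{..<N} \<rightarrow>\<^sub>E {..N}"
  define S where "S = segre N ` {x. \<forall>a<N. x a \<in> C}"
  define e where "e i = restrict (\<lambda>_. i) {..<N}" for i :: nat
  have e: "e i \<in> ?I" if "i \<le> N" for i using that by (auto simp: e_def)
  have coneS: "cone S" unfolding S_def using C N by (intro cone_segre) (auto simp: closed_cone_def)
  obtain i0 where i0: "i0 \<le> N" "p i0 \<noteq> 0" using p by (auto simp: pvec_def)
  \<comment> \<open>Minors comparing the diagonal Segre entries with \<open>p\<close>. Since
    \<open>p i0 \<noteq> 0\<close>, those involving \<open>i0\<close> suffice, which leaves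
    \<open>N\<close> equations.\<close>
  define F where "F k z = p i0 * z (e k) - p k * z (e i0)" for k and z :: "(nat \<Rightarrow> nat) \<Rightarrow> complex"
  define K where "K = {..N} - {i0}"
  have K: "finite K" "card K = N" using i0 by (auto simp: K_def)
  \<comment> \<open>The index \<open>e 0\<close>, and \<open>e 0\<close> with slot
    \<open>b - 1\<close> changed to 1: for points with coordinates \<open>1, s\<close> in positions
    0 and 1 these entries are 1 and the parameter \<open>s\<close> of the factor
    \<open>b - 1\<close>, so all ratios can be prescribed.\<close>
  define u where "u b z = z (if b = 0 then e 0 else (e 0)(b - 1 := 1))"
    for b and z :: "(nat \<Rightarrow> nat) \<Rightarrow> complex"
  have "(e 0)(b - 1 := 1) \<in> ?I" if "b \<le> N" "b \<noteq> 0" for b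
    using that by (auto simp: e_def PiE_iff extensional_def)
  then have u: "poly_fun ?I (u b)" if "b \<le> card K" for b
    using that K(2) e[of 0] unfolding u_def[abs_def] by (cases "b = 0") (auto intro: pf_var)
  obtain y where y: "\<And>s. y s \<in> C" "\<And>s. y s 0 = 1" "\<And>s. y s 1 = s" using onto by metis
  have "alg_indep S (card K) u"
  proof (rule alg_indep_grid[of "\<lambda>_. UNIV"])
    fix t :: complex and l :: "nat \<Rightarrow> complex" assume t: "t \<noteq> 0"
    define x where "x a = y (l (Suc a))" for a
    have "segre N x \<in> S" using y(1) by (auto simp: S_def x_def)
    then have "(\<lambda>j. t * segre N x j) \<in> S" using coneD[OF coneS] t by blast
    moreover have "segre N x (e 0) = 1" by (simp add: segre_def e_def x_def y)
    moreover have "segre N x ((e 0)(b - 1 := 1)) = l b" if "b \<in> {1..N}" for b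
    proof -
      have "segre N x ((e 0)(b - 1 := 1)) = (\<Prod>a<N. if a = b - 1 then l b else 1)"
        unfolding segre_def using that by (intro prod.cong) (auto simp: e_def x_def y y(3)[unfolded One_nat_def])
      moreover have "b - 1 < N" using that by auto
      ultimately show ?thesis by simp
    qed
    ultimately show "\<exists>z\<in>S. u 0 z = t \<and> (\<forall>i\<in>{1..card K}. u i z = t * l i)"
      unfolding K(2) by (intro bexI[of _ "\<lambda>j. t * segre N x j"]) (auto simp: u_def)
  qed (simp add: infinite_UNIV_char_0)
  moreover have "hom_fun ?I 1 (F k)" if "k \<in> K" for k
    unfolding F_def[abs_def] using that e i0(1) by (intro hom_diff hom_scale hom_var) (auto simp: K_def)
  ultimately have "\<exists>r\<in>hom_closure ?I S. \<forall>k\<in>K. F k r = 0"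
    using u by (intro common_zero_of_linear_forms[OF _ coneS K(1)]) (auto intro: finite_PiE)
  then obtain r where r: "r \<in> hom_closure ?I S" "\<And>k. k \<in> K \<Longrightarrow> F k r = 0" by blast
  obtain x q where x: "\<And>a. a < N \<Longrightarrow> x a \<in> C" and q: "q \<noteq> 0"
    "\<And>i. i \<le> N \<Longrightarrow> (\<Prod>a<N. x a i) = q * r (e i)"
    using hom_closure_segre[OF C N r(1)[unfolded S_def]] unfolding e_def by blast
  define w where "w i = (\<Prod>a<N. x a i)" for i
  have proportional: "p i0 * w k = p k * w i0" if "k \<le> N" for k
  proof (cases "k = i0")
    case False
    then have "p i0 * r (e k) = p k * r (e i0)" using r(2)[of k] that by (simp add: K_def F_def)
    then show ?thesis using q(2) that i0(1) by (simp add: w_def mult.left_commute)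
  qed simp
  obtain i where i: "i \<le> N" "\<forall>a<N. x a i \<noteq> 0"
    using common_nonzero_coordinate[of N x] zeros x by blast
  then have "w i \<noteq> 0" by (simp add: w_def)
  \<comment> \<open>If \<open>w i0\<close> were 0, proportionality at \<open>i\<close> would give
    \<open>p i0 * w i = 0\<close>.\<close>
  then have w0: "w i0 \<noteq> 0" using proportional[OF i(1)] i0(2) by auto
  define c where "c = p i0 / w i0"
  have "p k = c * w k" for k
  proof (cases "k \<le> N")
    case True
    then show ?thesis using proportional[OF True] w0 by (simp add: c_def field_simps)
  next
    case False
    have "pvec N (x 0)" using x[of 0] N C by (auto simp: closed_cone_def)
    then have "w k = 0" using False N unfolding w_def by (intro prod_zero) (auto simp: pvec_def intro!: bexI[of _ 0])
    then show ?thesis using False p by (simp add: pvec_def)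
  qed
  then have "p = (\<lambda>k. c * (\<Prod>a<N. x a k))" unfolding w_def by (rule ext)
  moreover have "c \<noteq> 0" using w0 i0(2) by (simp add: c_def)
  ultimately show ?thesis using x by blast
qed

section \<open>Bound for the Hadamard rank\<close>

theorem mainTheorem2:
  fixes N n :: nat and X :: "(nat \<Rightarrow> complex) set"
  assumes "proj_irreducible N X"
    and "proj_dim N X n"
    and "n \<ge> 1"
    and "2 * n \<le> N"
    and "X \<inter> Delta N (N - n - 1) = {}"
  shows "\<forall>p. pvec N p \<longrightarrow> Hrk N X p \<le> enat N"
proof (intro allI impI)
  fix p assume p: "pvec N p"
  have closed: "proj_closed N X" using assms(1) by (simp add: proj_irreducible_def)
  have X: "closed_cone N X" using closed by (rule proj_closed_closed_cone)
  obtain Z where Z: "irred_chain N X Z n" using assms(2) by (auto simp: proj_dim_def)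
  obtain m where m: "n = Suc m" using assms(3) by (cases n) auto
  have "card (zero_coords N z) \<le> Suc m" if "z \<in> X" for z
  proof -
    have "z \<notin> Delta N (N - n - 1)" using that assms(5) by blast
    \<comment> \<open>As \<open>n \<ge> 1\<close> and \<open>2 * n \<le> N\<close> give
      \<open>n < N\<close>, the bound \<open>N - n - 1 + 1\<close> in \<open>Delta\<close> equals
      \<open>N - n\<close> despite truncated subtraction.\<close>
    then have "card {j. j \<le> N \<and> z j \<noteq> 0} > N - n"
      using proj_closed_pvec[OF closed that] assms(3,4) by (simp add: Delta_def)
    moreover have "{..N} = {j. j \<le> N \<and> z j \<noteq> 0} \<union> zero_coords N z"
      by (auto simp: zero_coords_def)
    then have "card {..N} = card {j. j \<le> N \<and> z j \<noteq> 0} + card (zero_coords N z)"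
      by (metis (no_types, lifting) card_Un_disjoint card_atMost finite_Un finite_atMost disjoint_iff mem_Collect_eq zero_coords_def)
    ultimately show ?thesis using m by simp
  qed
  moreover have "Suc m \<le> N" using assms(4) m by simp
  ultimately obtain G where G: "\<And>l. l < m \<Longrightarrow> hom_fun {..N} 1 (G l)"
    "\<And>z. z \<in> X \<Longrightarrow> \<forall>l<m. G l z = 0 \<Longrightarrow> card (zero_coords N z) \<le> 1"
    using curve_section[OF X, of m] by blast
  define C where "C = {z\<in>X. \<forall>h\<in>G ` {..<m}. h z = 0}"
  have C: "closed_cone N C"
    unfolding C_def using G(1) by (intro closed_cone_Int_zeros[OF X]) blast
  have zeros: "card (zero_coords N z) \<le> 1" if "z \<in> C" for z
    using that G(2) by (auto simp: C_def)
  have "\<exists>z\<in>C. z 0 = 1 \<and> z 1 = s" for s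
  proof -
    \<comment> \<open>Exactly \<open>n = Suc m\<close> forms: the \<open>m\<close> that cut out
      \<open>C\<close>, and at index \<open>m\<close> the equation
      \<open>z 1 = s * z 0\<close>.\<close>
    have "\<exists>r\<in>X. \<forall>k\<in>{..m}. (if k < m then G k else (\<lambda>z. z 1 - s * z 0)) r = 0"
    proof (rule irred_chain_common_zero[OF closed Z])
      fix k
      have "hom_fun {..N} 1 (\<lambda>z. z 1 - s * z 0)"
        using assms(3,4) by (intro hom_diff hom_scale hom_var) auto
      then show "hom_fun {..N} 1 (if k < m then G k else (\<lambda>z. z 1 - s * z 0))" using G(1) by simp
    qed (simp_all add: m)
    then obtain r where r: "r \<in> X" "\<And>k. k \<le> m \<Longrightarrow> (if k < m then G k else (\<lambda>z. z 1 - s * z 0)) r = 0" by auto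
    have "r \<in> C" using r(1) r(2)[OF less_imp_le] by (force simp: C_def)
    have r1: "r 1 = s * r 0" using r(2)[of m] by simp
    \<comment> \<open>Otherwise the coordinates 0 and 1 would both vanish, but points of
      \<open>C\<close> have at most one zero coordinate.\<close>
    have "r 0 \<noteq> 0"
    proof
      assume "r 0 = 0"
      then have "{0, 1} \<subseteq> zero_coords N r" using r1 assms(3,4) by (auto simp: zero_coords_def)
      from card_mono[OF finite_zero_coords this] zeros[OF \<open>r \<in> C\<close>] show False by simp
    qed
    then have "(\<lambda>i. (1 / r 0) * r i) \<in> C" using C \<open>r \<in> C\<close> by (intro coneD) (auto simp: closed_cone_def)
    then show ?thesis using \<open>r 0 \<noteq> 0\<close> r1 by (intro bexI[of _ "\<lambda>i. (1 / r 0) * r i"]) auto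
  qed
  then obtain x q where x: "\<And>a. a < N \<Longrightarrow> x a \<in> C" and q: "q \<noteq> 0" "p = (\<lambda>i. q * (\<Prod>a<N. x a i))"
    using hadamard_product_of_curve_points[OF C zeros _ _ p] assms(3,4) by auto
  define ps where "ps = map x [0..<N]"
  have prod: "hprod ps = (\<lambda>i. \<Prod>a<N. x a i)"
    by (simp add: hprod_def ps_def comp_def prod.list_conv_set_nth atLeast0LessThan)
  have "hadamard_decomp N X p N"
    unfolding hadamard_decomp_def
  proof (intro exI[of _ ps] conjI)
    show "length ps = N" "N \<ge> 1" using assms(3,4) by (auto simp: ps_def)
    show "set ps \<subseteq> X" using x by (auto simp: ps_def C_def)
    show "pvec N (hprod ps)" using p q by (auto simp: prod pvec_def)
    show "proj_eq (hprod ps) p" unfolding proj_eq_def prod using q by blast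
  qed
  then show "Hrk N X p \<le> enat N" unfolding Hrk_def by (auto intro: Least_le)
qed

end
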